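(* Let $G$ be a connected, locally compact, compactly generated group, and let $\mu$ be a courteous probability measure on $G$. If $G$ is nilpotent, then for all integers $k\ge1$, $HF_k(G,\mu)\subset P^k(G)$; that is, every $\mu$-harmonic function on $G$ of polynomial growth of degree at most $k$ is a polynomial on $G$ of degree at most $k$.
   Context: Let $S$ be a compact symmetric ($S=S^{-1}$) subset of $G$ containing $1$ with $G=\bigcup_{n\ge1}S^n$, where $S^n=\{s_1\cdots s_n: s_i\in S\}$ and $S^0=\{1\}$. Let $\mathfrak m$ be the left Haar measure on $G$ normalized so that $\mathfrak m(S)=1$. Put $|x|=\min\{n: x\in S^n\}$, the word length. A probability measure $\mu$ on $G$ is courteous if: (i) $\mu$ has a continuous density with respect to $\mathfrak m$; (ii) $\mu(A)=\mu(A^{-1})$ for all measurable $A$; (iii) the support of $\mu$ generates $G$; (iv) $\mu$ has exponential tail: there is $c_\mu>0$ with $\mu(\{x:|x|>t\})\le e^{-c_\mu t}$ for all sufficiently large $t$. A measurable function $f:G\to\mathbb C$ is $\mu$-harmonic if $f(x)=\int_G f(xs)\,d\mu(s)$ for all $x\in G$. Put $\|f\|_k=\limsup_{r\to\infty} r^{-k}\sup\{|f(x)|:|x|\le r\}$. $HF_k(G,\mu)$ is the complex vector space of all $\mu$-harmonic $f:G\to\mathbb C$ with $\|f\|_k<\infty$. It does not depend on the choice of $S$. For $f:G\to\mathbb C$ and $u\in G$ the left derivative is $\partial_u f(x)=f(ux)-f(x)$. $P^k(G)$ is the space of functions $f:G\to\mathbb C$ with $\partial_{u_1}\cdots\partial_{u_{k+1}}f=0$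 for all $u_1,\dots,u_{k+1}\in G$ (polynomials on $G$ of degree at most $k$). *)

theory Defs
  imports "HOL-Probability.Probability"
begin

text \<open>
  Topological groups are types of class \<^class>\<open>topological_group_add\<close>. This class does not assume
  commutativity: the group law \<open>x y\<close> is written \<open>x + y\<close>, the inverse of \<open>x\<close> is \<open>- x\<close>, the
  identity is \<open>0\<close>, and the order of summands matters throughout. Locally compact groups are
  Hausdorff by convention, which is expressed by the additional class \<^class>\<open>t2_space\<close>.
\<close>

inductive_set generated_subgroup :: "'a::group_add set \<Rightarrow> 'a set" for A where
  zero: "0 \<in> generated_subgroup A"
| incl: "x \<in> A \<Longrightarrow> x \<in> generated_subgroup A"
| add: "x \<in> generated_subgroup A \<Longrightarrow> y \<in> generated_subgroup A \<Longrightarrow> x + y \<in> generated_subgroup A"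
| uminus: "x \<in> generated_subgroup A \<Longrightarrow> - x \<in> generated_subgroup A"

fun lower_central_series :: "nat \<Rightarrow> 'a::group_add set" where
  "lower_central_series 0 = UNIV"
| "lower_central_series (Suc n) =
     generated_subgroup {- x + - y + x + y | x y. x \<in> lower_central_series n}"

text \<open>The argument only carries the type of the group.\<close>

definition nilpotent_group :: "'a::group_add itself \<Rightarrow> bool" where
  "nilpotent_group _ \<longleftrightarrow> (\<exists>n. lower_central_series n = {0::'a})"

text \<open>The set \<open>S\<^sup>n\<close> of products of \<open>n\<close> elements of \<open>S\<close>.\<close>

fun set_pow :: "'a::group_add set \<Rightarrow> nat \<Rightarrow> 'a set" where
  "set_pow S 0 = {0}"
| "set_pow S (Suc n) = {x + s | x s. x \<in> set_pow S n \<and> s \<in> S}"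

definition compact_symmetric_generating :: "'a::topological_group_add set \<Rightarrow> bool" where
  "compact_symmetric_generating S \<longleftrightarrow>
     compact S \<and> uminus ` S = S \<and> 0 \<in> S \<and> (\<Union>n\<in>{1..}. set_pow S n) = UNIV"

definition word_length :: "'a::group_add set \<Rightarrow> 'a \<Rightarrow> nat" where
  "word_length S x = (LEAST n. x \<in> set_pow S n)"

text \<open>A left Haar measure is a nonzero left-invariant Radon measure on the Borel sets.\<close>

definition left_haar_measure :: "'a::topological_group_add measure \<Rightarrow> bool" where
  "left_haar_measure m \<longleftrightarrow>
     sets m = sets borel \<and>
     emeasure m UNIV \<noteq> 0 \<and>
     (\<forall>K. compact K \<longrightarrow> emeasure m K < \<infinity>) \<and>
     (\<forall>A\<in>sets borel. emeasure m A = (INF U\<in>{U. open U \<and> A \<subseteq> U}. emeasure m U)) \<and>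
     (\<forall>U. open U \<longrightarrow> emeasure m U = (SUP K\<in>{K. compact K \<and> K \<subseteq> U}. emeasure m K)) \<and>
     (\<forall>x. \<forall>A\<in>sets borel. emeasure m ((\<lambda>y. x + y) ` A) = emeasure m A)"

definition measure_support :: "'a::topological_space measure \<Rightarrow> 'a set" where
  "measure_support \<mu> = {x. \<forall>U. open U \<longrightarrow> x \<in> U \<longrightarrow> emeasure \<mu> U > 0}"

definition courteous ::
  "'a::topological_group_add measure \<Rightarrow> 'a set \<Rightarrow> 'a measure \<Rightarrow> bool" where
  "courteous m S \<mu> \<longleftrightarrow>
     prob_space \<mu> \<and> sets \<mu> = sets borel \<and>
     (\<exists>h. continuous_on UNIV h \<and> (\<forall>x. 0 \<le> h x) \<and> \<mu> = density m (\<lambda>x. ennreal (h x))) \<and>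
     (\<forall>A\<in>sets borel. emeasure \<mu> A = emeasure \<mu> (uminus ` A)) \<and>
     generated_subgroup (measure_support \<mu>) = UNIV \<and>
     (\<exists>c>0. \<forall>\<^sub>F t in at_top. measure \<mu> {x. real (word_length S x) > t} \<le> exp (- c * t))"

text \<open>
  Integrability has to be required explicitly, because the integral of a non-integrable
  function is \<open>0\<close> in the library.
\<close>

definition harmonic :: "'a::topological_group_add measure \<Rightarrow> ('a \<Rightarrow> complex) \<Rightarrow> bool" where
  "harmonic \<mu> f \<longleftrightarrow>
     f \<in> borel_measurable borel \<and>
     (\<forall>x. integrable \<mu> (\<lambda>s. f (x + s)) \<and> f x = (\<integral>s. f (x + s) \<partial>\<mu>))"

definition growth_norm :: "'a::group_add set \<Rightarrow> nat \<Rightarrow> ('a \<Rightarrow> complex) \<Rightarrow> ereal" where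
  "growth_norm S k f =
     Limsup at_top (\<lambda>r::real.
       ereal (1 / r ^ k) * (SUP x\<in>{x. real (word_length S x) \<le> r}. ereal (cmod (f x))))"

definition HF ::
  "'a::topological_group_add set \<Rightarrow> nat \<Rightarrow> 'a measure \<Rightarrow> ('a \<Rightarrow> complex) set" where
  "HF S k \<mu> = {f. harmonic \<mu> f \<and> growth_norm S k f < \<infinity>}"

definition left_deriv :: "'a::group_add \<Rightarrow> ('a \<Rightarrow> complex) \<Rightarrow> 'a \<Rightarrow> complex" where
  "left_deriv u f = (\<lambda>x. f (u + x) - f x)"

definition group_poly :: "nat \<Rightarrow> ('a::group_add \<Rightarrow> complex) set" where
  "group_poly k = {f. \<forall>us. length us = k + 1 \<longrightarrow> foldr left_deriv us f = (\<lambda>x. 0)}"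

end

theory Submission
  imports Defs
begin

text \<open>
  Let \<open>X\<^sub>n\<close> be the right random walk with step distribution \<open>\<mu>\<close>. For harmonic \<open>f\<close> the sequence
  \<open>f (x X\<^sub>n)\<close> is a martingale, so the mean squares of its increments sum up to at most
  \<open>E |f (x X\<^sub>n)|\<^sup>2\<close>, which grows polynomially in \<open>n\<close>. If \<open>f (u x y) = f (x u y)\<close> for all \<open>x\<close>, \<open>y\<close>,
  then \<open>\<partial>\<^sub>u f\<close> is controlled by finitely many of these increments, because convolution powers of \<open>\<mu>\<close>
  dominate Haar measure near any given point. As \<open>|\<partial>\<^sub>u f|\<^sup>2\<close> is subharmonic, \<open>E |\<partial>\<^sub>u f (x X\<^sub>n)|\<^sup>2\<close> is
  smaller than \<open>E |f (x X\<^sub>2\<^sub>n)|\<^sup>2\<close> by a factor of order \<open>n\<close>; hence a bounded number of such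
  derivatives annihilates \<open>f\<close>.

  Functions invariant under a term of the lower central series satisfy the commutation hypothesis
  for \<open>u\<close> in the preceding term. Climbing down the series, every harmonic function of
  polynomial growth is a polynomial of some degree. Its top-order derivatives are additive in each
  direction, so the growth bound forces the degree to be at most \<open>k\<close>.
\<close>

section \<open>Word length and its balls\<close>

lemma set_pow_add:
  fixes S :: "'a::group_add set"
  assumes "x \<in> set_pow S i" "y \<in> set_pow S j"
  shows "x + y \<in> set_pow S (i + j)"
  using assms(2)
proof (induction j arbitrary: y)
  case (Suc j)
  then obtain z s where "y = z + s" "z \<in> set_pow S j" "s \<in> S" by auto
  with Suc.IH[of z] show ?case by (auto simp: add.assoc[symmetric])
qed (use assms(1) in simp)

lemma set_pow_mono:
  fixes S :: "'a::group_add set"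
  assumes "0 \<in> S" "i \<le> j"
  shows "set_pow S i \<subseteq> set_pow S j"
  using assms(2) by (induction j rule: dec_induct) (use assms(1) in force)+

text \<open>The powers increase because \<open>0\<close> lies in \<open>S\<close>, so each ball is a
  single power of \<open>S\<close>; this makes balls compact, hence closed and Borel.\<close>

lemma word_length_le_iff:
  fixes S :: "'a::group_add set"
  assumes "0 \<in> S" "(\<Union>n\<in>{1..}. set_pow S n) = UNIV"
  shows "word_length S x \<le> n \<longleftrightarrow> x \<in> set_pow S n"
proof
  have "x \<in> (\<Union>n\<in>{1..}. set_pow S n)" using assms(2) by simp
  then have "\<exists>n. x \<in> set_pow S n" by blast
  then have "x \<in> set_pow S (word_length S x)"
    unfolding word_length_def by (rule LeastI_ex)
  then show "word_length S x \<le> n \<Longrightarrow> x \<in> set_pow S n"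
    using set_pow_mono[OF assms(1)] by blast
qed (simp add: word_length_def Least_le)

lemma word_length_add_le:
  fixes S :: "'a::group_add set"
  assumes "0 \<in> S" "(\<Union>n\<in>{1..}. set_pow S n) = UNIV"
  shows "word_length S (x + y) \<le> word_length S x + word_length S y"
  using word_length_le_iff[OF assms] set_pow_add by blast

lemma compact_set_pow:
  fixes S :: "'a::topological_group_add set"
  assumes "compact S"
  shows "compact (set_pow S n)"
proof (induction n)
  case (Suc n)
  have "set_pow S (Suc n) = (\<lambda>p. fst p + snd p) ` (set_pow S n \<times> S)" by force
  moreover have "compact \<dots>"
    by (intro compact_continuous_image compact_Times Suc.IH assms continuous_intros)
  ultimately show ?case by simp
qed simp

subsection \<open>Iterated left derivatives\<close>

lemma foldr_left_deriv_add:
  "foldr left_deriv us (\<lambda>x. f x + g x) = (\<lambda>x. foldr left_deriv us f x + foldr left_deriv us g x)"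
  by (induction us) (auto simp: left_deriv_def)

lemma foldr_left_deriv_scale:
  "foldr left_deriv us (\<lambda>x. c * f x) = (\<lambda>x. c * foldr left_deriv us f x)"
  by (induction us) (auto simp: left_deriv_def algebra_simps)

lemma foldr_left_deriv_zero: "foldr left_deriv us (\<lambda>x. 0) = (\<lambda>x. 0)"
  by (induction us) (auto simp: left_deriv_def)

lemma foldr_left_deriv_mono:
  assumes "\<And>us. length us = i \<Longrightarrow> foldr left_deriv us f = (\<lambda>x. 0)" "i \<le> length us"
  shows "foldr left_deriv us f = (\<lambda>x. 0)"
proof -
  have "us = take (length us - i) us @ drop (length us - i) us" by simp
  then have "foldr left_deriv us f =
      foldr left_deriv (take (length us - i) us) (foldr left_deriv (drop (length us - i) us) f)"
    by (metis foldr_append comp_apply)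
  then show ?thesis using assms by (simp add: foldr_left_deriv_zero)
qed

text \<open>Derivatives are additive in the direction up to a second-order term, which disappears
  when applied at top degree.\<close>

lemma left_deriv_add_point:
  fixes g :: "'a::group_add \<Rightarrow> complex"
  shows "left_deriv (u + v) g = (\<lambda>x. left_deriv v (left_deriv u g) x + (left_deriv v g x + left_deriv u g x))"
  by (auto simp: left_deriv_def add.assoc)

fun nmult :: "nat \<Rightarrow> 'a::group_add \<Rightarrow> 'a" where
  "nmult 0 u = 0"
| "nmult (Suc n) u = nmult n u + u"

lemma foldr_left_deriv_nmult1:
  assumes "\<And>us. length us = Suc d \<Longrightarrow> foldr left_deriv us f = (\<lambda>x. 0)"
    and "length vs + length ws + 1 = d"
  shows "foldr left_deriv (vs @ nmult n u # ws) f = (\<lambda>x. of_nat n * foldr left_deriv (vs @ u # ws) f x)"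
proof (induction n)
  case 0
  have "left_deriv 0 g = (\<lambda>x. 0)" for g :: "'a \<Rightarrow> complex" by (auto simp: left_deriv_def)
  then show ?case by (simp add: foldr_left_deriv_zero)
next
  case (Suc n)
  \<comment> \<open>The mixed term carries \<open>d + 1\<close> directions, so it vanishes by
    hypothesis.\<close>
  have "foldr left_deriv (vs @ u # nmult n u # ws) f = (\<lambda>x. 0)"
    using assms by (intro assms(1)) simp
  then have "foldr left_deriv (vs @ nmult (Suc n) u # ws) f =
      (\<lambda>x. foldr left_deriv (vs @ u # ws) f x + foldr left_deriv (vs @ nmult n u # ws) f x)"
    by (simp add: left_deriv_add_point foldr_left_deriv_add fun_eq_iff)
  then show ?case by (simp only: Suc.IH) (simp add: algebra_simps)
qed

text \<open>One slot is scaled at a time; \<open>vs\<close> is kept arbitrary so that the slots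
  already scaled can move into it.\<close>

lemma foldr_left_deriv_nmult:
  assumes "\<And>us. length us = Suc d \<Longrightarrow> foldr left_deriv us f = (\<lambda>x. 0)"
    and "length vs + length ws = d"
  shows "foldr left_deriv (vs @ map (nmult n) ws) f =
      (\<lambda>x. of_nat n ^ length ws * foldr left_deriv (vs @ ws) f x)"
  using assms(2)
proof (induction ws arbitrary: vs)
  case (Cons w ws)
  have "foldr left_deriv (vs @ map (nmult n) (w # ws)) f
     = foldr left_deriv ((vs @ [nmult n w]) @ map (nmult n) ws) f" by simp
  also have "\<dots> = (\<lambda>x. of_nat n ^ length ws * foldr left_deriv ((vs @ [nmult n w]) @ ws) f x)"
    by (rule Cons.IH) (use Cons.prems in simp)
  also have "foldr left_deriv ((vs @ [nmult n w]) @ ws) f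
     = (\<lambda>x. of_nat n * foldr left_deriv (vs @ w # ws) f x)"
    using foldr_left_deriv_nmult1[OF assms(1), where vs = vs and ws = ws and n = n and u = w]
      Cons.prems by simp
  finally show ?case by (simp add: algebra_simps)
qed simp

text \<open>The \<open>d\<close>-fold derivatives of a polynomial of degree \<open>d\<close> are additive in each direction, so
  replacing the directions \<open>u\<close> by \<open>n u\<close> multiplies them by \<open>n ^ d\<close>, while the growth
  hypothesis allows only a factor \<open>n ^ k\<close>.\<close>

lemma group_poly_degree_reduce:
  fixes f :: "'a::group_add \<Rightarrow> complex"
  assumes gen: "0 \<in> S" "(\<Union>n\<in>{1..}. set_pow S n) = UNIV"
    and growth: "\<And>x. cmod (f x) \<le> A * (1 + real (word_length S x)) ^ k"
    and d: "\<And>us. length us = Suc d \<Longrightarrow> foldr left_deriv us f = (\<lambda>x. 0)"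
    and "k < d" and us: "length us = d"
  shows "foldr left_deriv us f = (\<lambda>x. 0)"
proof
  fix x
  let ?w = "word_length S"
  note wadd = word_length_add_le[OF gen]
  have "cmod (f 0) \<le> A * (1 + real (?w 0)) ^ k" by (rule growth)
  then have A: "A \<ge> 0"
    using norm_ge_zero[of "f 0"] zero_less_power[of "1 + real (?w 0)" k]
    by (smt (verit) mult_neg_pos of_nat_0_le_iff)
  \<comment> \<open>A derivative is a difference of two values: each direction doubles the constant
    and lengthens the argument by at most its own word length.\<close>
  have bound: "cmod (foldr left_deriv vs f y) \<le>
      2 ^ length vs * (A * (1 + real (?w y) + (\<Sum>v\<leftarrow>vs. real (?w v))) ^ k)" for vs y
  proof (induction vs arbitrary: y)
    case (Cons v vs)
    let ?s = "\<Sum>v\<leftarrow>vs. real (?w v)"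
    have s: "0 \<le> ?s" by (intro sum_list_nonneg) auto
    have "cmod (foldr left_deriv (v # vs) f y) \<le>
       cmod (foldr left_deriv vs f (v + y)) + cmod (foldr left_deriv vs f y)"
      by (simp add: left_deriv_def norm_triangle_ineq4)
    also have "\<dots> \<le> 2 ^ length vs * (A * (1 + real (?w (v + y)) + ?s) ^ k)
       + 2 ^ length vs * (A * (1 + real (?w y) + ?s) ^ k)"
      by (intro add_mono Cons.IH)
    also have "\<dots> \<le> 2 ^ length vs * (A * (1 + real (?w y) + (real (?w v) + ?s)) ^ k)
       + 2 ^ length vs * (A * (1 + real (?w y) + (real (?w v) + ?s)) ^ k)"
    proof -
      have "1 + real (?w (v + y)) + ?s \<le> 1 + real (?w y) + (real (?w v) + ?s)"
        using wadd[of v y] by linarith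
      then have "(1 + real (?w (v + y)) + ?s) ^ k \<le> (1 + real (?w y) + (real (?w v) + ?s)) ^ k"
        using s by (intro power_mono) auto
      moreover have "(1 + real (?w y) + ?s) ^ k \<le> (1 + real (?w y) + (real (?w v) + ?s)) ^ k"
        using s by (intro power_mono) auto
      ultimately show ?thesis using A by (intro add_mono mult_left_mono) auto
    qed
    finally show ?case by (simp add: algebra_simps)
  qed (use growth in simp)
  let ?c = "cmod (foldr left_deriv us f x)"
  define B where "B = 2 ^ d * A * (1 + real (?w x) + (\<Sum>v\<leftarrow>us. real (?w v))) ^ k"
  have w0: "?w 0 = 0" using word_length_le_iff[OF gen, of 0 0] by simp
  have wn: "real (?w (nmult n u)) \<le> real n * real (?w u)" for n u
  proof (induction n)
    case (Suc n)
    then show ?case using wadd[of "nmult n u" u] by (simp add: algebra_simps)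
  qed (simp add: w0)
  \<comment> \<open>Comparing \<open>n ^ d\<close> with \<open>n ^ k\<close> leaves at least one
    spare factor \<open>n\<close>, so \<open>?c\<close> must be zero.\<close>
  have key: "real n * ?c \<le> B" if n: "n \<ge> 1" for n
  proof -
    have sn: "(\<Sum>v\<leftarrow>map (nmult n) us. real (?w v)) \<le> real n * (\<Sum>v\<leftarrow>us. real (?w v))"
      using wn by (induction us) (auto simp: algebra_simps intro: add_mono)
    have s0: "0 \<le> (\<Sum>v\<leftarrow>map (nmult n) us. real (?w v))" by (intro sum_list_nonneg) auto
    have s1: "1 + real (?w x) \<le> real n * (1 + real (?w x))"
      using n mult_right_mono[of 1 "real n" "1 + real (?w x)"] by simp
    have "foldr left_deriv ([] @ map (nmult n) us) f
        = (\<lambda>x. of_nat n ^ length us * foldr left_deriv ([] @ us) f x)"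
      by (rule foldr_left_deriv_nmult[OF d]) (use us in auto)
    then have "real n ^ d * ?c = cmod (foldr left_deriv (map (nmult n) us) f x)"
      using us by (simp add: norm_mult norm_power)
    also have "\<dots> \<le> 2 ^ d * (A * (1 + real (?w x) + (\<Sum>v\<leftarrow>map (nmult n) us. real (?w v))) ^ k)"
      using bound[of "map (nmult n) us" x] us by simp
    also have "\<dots> \<le> 2 ^ d * (A * (real n * (1 + real (?w x) + (\<Sum>v\<leftarrow>us. real (?w v)))) ^ k)"
      using sn s0 s1 A by (intro mult_left_mono power_mono) (auto simp: algebra_simps)
    also have "\<dots> = real n ^ k * B" by (simp add: B_def power_mult_distrib)
    finally have *: "real n ^ d * ?c \<le> real n ^ k * B" .
    have "real n ^ k * (real n * ?c) = real n ^ Suc k * ?c" by simp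
    also have "\<dots> \<le> real n ^ d * ?c"
      using n \<open>k < d\<close> by (intro mult_right_mono power_increasing) auto
    also note *
    finally show ?thesis using n by (subst (asm) mult_le_cancel_left_pos) auto
  qed
  have "?c = 0"
  proof (rule ccontr)
    assume "?c \<noteq> 0"
    then have c: "?c > 0" by simp
    obtain n where n: "B < real n * ?c" using reals_Archimedean3[OF c] by blast
    have "real n * ?c \<le> real (Suc n) * ?c" by (intro mult_right_mono) auto
    then show False using key[of "Suc n"] n by simp
  qed
  then show "foldr left_deriv us f x = 0" by simp
qed

text \<open>The limsup controls only radii beyond some \<open>r0\<close>. Testing the supremum at
  radius \<open>R + |x|\<close> rather than \<open>|x|\<close> also covers short words, at the price
  of a factor \<open>R ^ k\<close>.\<close>

lemma growth_norm_bound: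
  fixes f :: "'a::group_add \<Rightarrow> complex"
  assumes "growth_norm S k f < \<infinity>"
  shows "\<exists>A. \<forall>x. cmod (f x) \<le> A * (1 + real (word_length S x)) ^ k"
proof -
  obtain M where "growth_norm S k f < ereal M"
    using assms ereal_dense2[of "growth_norm S k f" \<infinity>] by blast
  then have "\<forall>\<^sub>F r in at_top. ereal (1 / r ^ k) *
      (SUP x\<in>{x. real (word_length S x) \<le> r}. ereal (cmod (f x))) < ereal M"
    unfolding growth_norm_def by (rule Limsup_lessD)
  then obtain r0 where r0: "\<And>r. r \<ge> r0 \<Longrightarrow> ereal (1 / r ^ k) *
      (SUP x\<in>{x. real (word_length S x) \<le> r}. ereal (cmod (f x))) < ereal M"
    unfolding eventually_at_top_linorder by blast
  define R where "R = max r0 1"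
  have "cmod (f x) \<le> (R ^ k * M) * (1 + real (word_length S x)) ^ k" for x
  proof -
    let ?w = "real (word_length S x)"
    let ?r = "R + ?w"
    have R: "R \<ge> 1" by (simp add: R_def)
    have rp: "?r ^ k > 0" using R by (intro zero_less_power) linarith
    have "ereal (1 / ?r ^ k) * ereal (cmod (f x)) \<le> ereal (1 / ?r ^ k) *
      (SUP x\<in>{x. real (word_length S x) \<le> ?r}. ereal (cmod (f x)))"
      using R rp by (intro ereal_mult_left_mono SUP_upper) auto
    also have "\<dots> < ereal M" by (rule r0) (simp add: R_def)
    finally have "cmod (f x) / ?r ^ k < M" by simp
    then have 1: "cmod (f x) \<le> M * ?r ^ k" using rp by (simp add: field_simps)
    have "M \<ge> 0" using \<open>cmod (f x) / ?r ^ k < M\<close> rp by (smt (verit) divide_nonneg_pos norm_ge_zero)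
    have "?r \<le> R * (1 + ?w)"
      using R mult_right_mono[of 1 R ?w] by (simp add: algebra_simps)
    then have "?r ^ k \<le> (R * (1 + ?w)) ^ k" using R by (intro power_mono) auto
    then have "M * ?r ^ k \<le> M * (R * (1 + ?w)) ^ k" using \<open>M \<ge> 0\<close> by (intro mult_left_mono)
    with 1 show ?thesis by (simp only: power_mult_distrib mult_ac)
  qed
  then show ?thesis by blast
qed

subsection \<open>The Markov operator\<close>

text \<open>The density \<open>h\<close> is fixed here so that all estimates refer to one continuous
  version of it.\<close>

locale courteous_walk =
  fixes S :: "'a::{topological_group_add, t2_space} set"
    and m \<mu> :: "'a measure" and h :: "'a \<Rightarrow> real"
  assumes connected_group: "connected (UNIV :: 'a set)"
    and compact_gen: "compact_symmetric_generating S"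
    and haar: "left_haar_measure m" "emeasure m S = 1"
    and court: "courteous m S \<mu>"
    and h_cont: "continuous_on UNIV h"
    and h_nonneg: "\<And>x. 0 \<le> h x"
    and mu_density: "\<mu> = density m (\<lambda>x. ennreal (h x))"
begin

abbreviation wl :: "'a \<Rightarrow> nat" where "wl \<equiv> word_length S"

text \<open>The summand \<open>1\<close> makes the weight submultiplicative and its powers
  increasing in the exponent.\<close>

definition wt :: "'a \<Rightarrow> real" where "wt x = 1 + real (wl x)"

text \<open>Steps multiply on the right, so this operator commutes with left translations and left
  derivatives of fixed functions are again fixed. The integral is meaningful on \<open>nice\<close>
  functions.\<close>

definition P :: "('a \<Rightarrow> real) \<Rightarrow> 'a \<Rightarrow> real" where
  "P \<phi> x = (\<integral>s. \<phi> (x + s) \<partial>\<mu>)"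

text \<open>The degree is left open: since \<open>\<mu>\<close> has all moments, this class is
  stable under sums, products, left translations and \<open>P\<close>, and every integral in sight
  exists.\<close>

definition nice :: "('a \<Rightarrow> real) \<Rightarrow> bool" where
  "nice \<phi> \<longleftrightarrow> \<phi> \<in> borel_measurable borel \<and> (\<exists>A p. \<forall>x. \<bar>\<phi> x\<bar> \<le> A * wt x ^ p)"

lemma S_facts: "compact S" "uminus ` S = S" "0 \<in> S" "(\<Union>n\<in>{1..}. set_pow S n) = UNIV"
  using compact_gen by (auto simp: compact_symmetric_generating_def)

lemmas wl_le_iff = word_length_le_iff[OF S_facts(3,4)]
lemmas wl_add = word_length_add_le[OF S_facts(3,4)]

lemma wt_ge1: "wt x \<ge> 1"
  by (simp add: wt_def)

lemma wt_add_le: "wt (x + y) \<le> wt x + real (wl y)"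
  using wl_add[of x y] by (simp add: wt_def)

lemma wt_add_le_mult: "wt (x + y) \<le> wt x * wt y"
proof -
  have "wt x + real (wl y) \<le> wt x * wt y"
    by (simp add: wt_def algebra_simps)
  then show ?thesis using wt_add_le[of x y] by linarith
qed

section \<open>Haar measure, left translation and measurability of the word length\<close>

lemma sets_m [measurable_cong]: "sets m = sets borel"
  using haar(1) by (auto simp: left_haar_measure_def)

lemma sets_mu [measurable_cong]: "sets \<mu> = sets borel"
  using court by (auto simp: courteous_def)

lemma space_m [simp]: "space m = UNIV"
  using sets_eq_imp_space_eq[OF sets_m] by simp

lemma space_mu [simp]: "space \<mu> = UNIV"
  using sets_eq_imp_space_eq[OF sets_mu] by simp

sublocale prob_space \<mu>
  using court by (auto simp: courteous_def)

lemma add_left_measurable [measurable]: "(\<lambda>y. x + y) \<in> borel_measurable (borel :: 'a measure)"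
  by (intro borel_measurable_continuous_onI continuous_intros)

lemma h_measurable [measurable]: "h \<in> borel_measurable borel"
  by (intro borel_measurable_continuous_onI h_cont)

lemma measurable_translate:
  "f \<in> measurable borel N \<Longrightarrow> (\<lambda>y. f (x + y :: 'a)) \<in> measurable borel N"
  by (rule measurable_compose[OF add_left_measurable])

lemma emeasure_compact: "compact K \<Longrightarrow> emeasure m K < \<infinity>"
  using haar(1) by (auto simp: left_haar_measure_def)

lemma emeasure_translate:
  "A \<in> sets borel \<Longrightarrow> emeasure m ((\<lambda>y. x + y) ` A) = emeasure m A"
  using haar(1) by (auto simp: left_haar_measure_def)

lemma translate_image_eq: "(\<lambda>y. x + y) ` A = (\<lambda>y. - x + y) -` (A :: 'a set)"
proof -
  have z: "z = x + (- x + z)" for z :: 'a by (simp add: add.assoc[symmetric])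
  show ?thesis using z by (auto simp: add.assoc[symmetric] intro!: image_eqI)
qed

lemma distr_translate: "distr m borel (\<lambda>y. x + y) = m"
proof (rule measure_eqI)
  fix A assume "A \<in> sets (distr m borel (\<lambda>y. x + y))"
  then have A: "A \<in> sets borel" by simp
  have "emeasure (distr m borel (\<lambda>y. x + y)) A = emeasure m ((\<lambda>y. x + y) -` A)"
    using A by (subst emeasure_distr) auto
  also have "(\<lambda>y. x + y) -` A = (\<lambda>y. - x + y) ` A" using translate_image_eq[of "- x" A] by simp
  finally show "emeasure (distr m borel (\<lambda>y. x + y)) A = emeasure m A"
    using emeasure_translate A by simp
qed (simp add: sets_m)

lemma nn_integral_translate:
  assumes [measurable]: "f \<in> borel_measurable borel"
  shows "(\<integral>\<^sup>+y. f (x + y) \<partial>m) = (\<integral>\<^sup>+y. f y \<partial>m)"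
proof -
  have "(\<integral>\<^sup>+y. f y \<partial>m) = (\<integral>\<^sup>+y. f y \<partial>distr m borel (\<lambda>y. x + y))" by (simp add: distr_translate)
  also have "\<dots> = (\<integral>\<^sup>+y. f (x + y) \<partial>m)" by (subst nn_integral_distr) auto
  finally show ?thesis by simp
qed

lemma integral_translate:
  fixes f :: "'a \<Rightarrow> real"
  assumes [measurable]: "f \<in> borel_measurable borel"
  shows "(\<integral>y. f (x + y) \<partial>m) = (\<integral>y. f y \<partial>m)"
proof -
  have "(\<integral>y. f y \<partial>m) = (\<integral>y. f y \<partial>distr m borel (\<lambda>y. x + y))" by (simp add: distr_translate)
  also have "\<dots> = (\<integral>y. f (x + y) \<partial>m)" by (subst integral_distr) auto
  finally show ?thesis by simp
qed

lemma closed_set_pow: "closed (set_pow S n)"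
  by (intro compact_imp_closed compact_set_pow S_facts)

lemma wl_le_sets [measurable]: "{x. wl x \<le> n} \<in> sets borel"
  by (simp add: wl_le_iff closed_set_pow)

lemma wl_measurable [measurable]: "wl \<in> measurable borel (count_space UNIV)"
proof (rule measurable_count_space_eq_countable[THEN iffD2])
  show "wl \<in> space borel \<rightarrow> UNIV \<and> (\<forall>a\<in>UNIV. wl -` {a} \<inter> space borel \<in> sets borel)"
  proof safe
    fix n
    have "wl -` {n} = {x. wl x \<le> n} - (\<Union>i<n. {x. wl x \<le> i})" 
      by (auto simp: not_le intro: antisym leI)
    also have "\<dots> \<in> sets borel" by measurable
    finally show "wl -` {n} \<inter> space borel \<in> sets borel" by simp
  qed simp
qed simp

lemma wt_measurable [measurable]: "wt \<in> borel_measurable borel"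
  unfolding wt_def by measurable

text \<open>A Steinhaus argument: as \<open>m S > 0\<close>, the set \<open>S - S\<close> is a neighbourhood of \<open>0\<close>.\<close>

lemma wl_le2_nhd: "\<exists>V. open V \<and> 0 \<in> V \<and> (\<forall>x\<in>V. wl x \<le> 2)"
proof -
  have Sb: "S \<in> sets borel" using S_facts(1) by (simp add: compact_imp_closed)
  then have "emeasure m S = (INF U\<in>{U. open U \<and> S \<subseteq> U}. emeasure m U)"
    using haar(1) by (auto simp: left_haar_measure_def)
  then have "(INF U\<in>{U. open U \<and> S \<subseteq> U}. emeasure m U) < 2" using haar(2) by simp
  then obtain U where U: "open U" "S \<subseteq> U" "emeasure m U < 2"
    by (auto simp: INF_less_iff)
  let ?W = "(\<lambda>p. fst p + snd p) -` U"
  have W: "open ?W" by (intro open_vimage U continuous_intros)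
  have "{0} \<times> S \<subseteq> ?W" using U by auto
  from Elementary_Topology.tube_lemma[OF S_facts(1) W this]
  obtain V where V: "0 \<in> V" "open V" "V \<times> S \<subseteq> ?W" by (elim exE conjE)
  have "wl v \<le> 2" if "v \<in> V" for v
  proof -
    have sub: "(\<lambda>y. v + y) ` S \<subseteq> U" using V that by auto
    have vS: "(\<lambda>y. v + y) ` S \<in> sets borel"
      using S_facts(1) by (intro borel_closed compact_imp_closed compact_continuous_image continuous_intros)
    \<comment> \<open>Two disjoint translates of \<open>S\<close> inside \<open>U\<close> would have
      total measure \<open>2\<close>, more than \<open>U\<close> has.\<close>
    have "(\<lambda>y. v + y) ` S \<inter> S \<noteq> {}"
    proof
      assume "(\<lambda>y. v + y) ` S \<inter> S = {}"
      then have "emeasure m ((\<lambda>y. v + y) ` S \<union> S) = emeasure m ((\<lambda>y. v + y) ` S) + emeasure m S"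
        using Sb vS by (intro plus_emeasure[symmetric]) (auto simp: sets_m)
      also have "\<dots> = 2" using emeasure_translate[OF Sb] haar(2) by simp
      finally have "2 \<le> emeasure m U"
        using emeasure_mono[of "(\<lambda>y. v + y) ` S \<union> S" U m] sub U by (auto simp: sets_m)
      then show False using U by simp
    qed
    then obtain s t where st: "s \<in> S" "t \<in> S" "v + s = t" by auto
    then have "v = t + - s" by (simp add: eq_diff_eq[symmetric])
    moreover have "- s \<in> S" using st S_facts(2) by blast
    ultimately have "v \<in> set_pow S (Suc (Suc 0))"
      using st by force
    then show ?thesis by (simp only: wl_le_iff numeral_2_eq_2)
  qed
  then show ?thesis using V by blast
qed

section \<open>Moments of the step distribution\<close>

text \<open>Half of the exponential tail rate absorbs the factor \<open>n ^ q\<close>; the other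
  half leaves a geometric series over the level sets of the word length.\<close>

lemma moment_integrable: "integrable \<mu> (\<lambda>s. real (wl s) ^ q)"
proof -
  obtain c where c: "c > 0" and "\<forall>\<^sub>F t in at_top. measure \<mu> {x. real (wl x) > t} \<le> exp (- c * t)"
    using court by (auto simp: courteous_def)
  then obtain T where T: "\<And>t. t \<ge> T \<Longrightarrow> measure \<mu> {x. real (wl x) > t} \<le> exp (- c * t)"
    by (auto simp: eventually_at_top_linorder)
  define a where "a n = real n ^ q * measure \<mu> {x. wl x = n}" for n
  have "((\<lambda>x::real. x ^ q / exp x) \<longlongrightarrow> 0) at_top" by (rule tendsto_power_div_exp_0)
  then have "\<forall>\<^sub>F x::real in at_top. x ^ q / exp x < 1" by (rule order_tendstoD) simp
  then obtain X where X: "\<And>x::real. x \<ge> X \<Longrightarrow> x ^ q / exp x < 1"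
    by (auto simp: eventually_at_top_linorder)
  \<comment> \<open>\<open>T + 1\<close> allows the tail bound at \<open>n - 1/2\<close>;
    \<open>2 * X / c\<close> makes \<open>exp (c * n / 2)\<close> dominate
    \<open>(c * n / 2) ^ q\<close>.\<close>
  obtain N where N: "real N \<ge> max (T + 1) (2 * X / c)" using real_arch_simple by blast
  have a_le: "norm (a n) \<le> (2 / c) ^ q * exp (c / 2) * exp (- (c / 2)) ^ n" if "n \<ge> N" for n
  proof -
    have n: "real n \<ge> T + 1" "real n \<ge> 2 * X / c" using N that by auto
    then have "c * real n / 2 \<ge> X" using c by (simp add: field_simps)
    from X[OF this] have "(c * real n / 2) ^ q \<le> exp (c * real n / 2)" by (simp add: field_simps)
    then have "(2 / c) ^ q * (c * real n / 2) ^ q \<le> (2 / c) ^ q * exp (c * real n / 2)"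
      using c by (intro mult_left_mono) auto
    then have 1: "real n ^ q \<le> (2 / c) ^ q * exp (c * real n / 2)"
      using c by (simp add: power_mult_distrib[symmetric])
    \<comment> \<open>The shift by \<open>1/2\<close> places the level set inside a strict
      tail.\<close>
    have "measure \<mu> {x. wl x = n} \<le> measure \<mu> {x. real (wl x) > real n - 1/2}"
      by (intro finite_measure_mono) auto
    also have "\<dots> \<le> exp (- c * (real n - 1/2))" by (rule T) (use n in simp)
    finally have "real n ^ q * measure \<mu> {x. wl x = n} \<le>
       ((2 / c) ^ q * exp (c * real n / 2)) * exp (- c * (real n - 1/2))"
      using 1 c by (intro mult_mono) auto
    also have "\<dots> = (2 / c) ^ q * exp (c / 2) * exp (- (c / 2)) ^ n"
      by (simp add: mult.assoc exp_add[symmetric] exp_of_nat_mult[symmetric] algebra_simps)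
    finally show ?thesis by (simp add: a_def)
  qed
  have "summable a"
  proof (rule summable_comparison_test')
    show "summable (\<lambda>n. (2 / c) ^ q * exp (c / 2) * exp (- (c / 2)) ^ n)"
      using c by (intro summable_mult summable_geometric) auto
  qed (rule a_le)
  then have fin: "(\<Sum>n. ennreal (a n)) \<noteq> top"
    by (rule ennreal_suminf_neq_top) (simp add: a_def)
  have "ennreal (real (wl x) ^ q) = (\<Sum>n. ennreal (real n ^ q) * indicator {x. wl x = n} x)" for x
    by (subst suminf_finite[of "{wl x}"]) (auto simp: indicator_def)
  then have "(\<integral>\<^sup>+x. ennreal (real (wl x) ^ q) \<partial>\<mu>) =
      (\<integral>\<^sup>+x. (\<Sum>n. ennreal (real n ^ q) * indicator {x. wl x = n} x) \<partial>\<mu>)" by simp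
  also have "\<dots> = (\<Sum>n. \<integral>\<^sup>+x. ennreal (real n ^ q) * indicator {x. wl x = n} x \<partial>\<mu>)"
    by (intro nn_integral_suminf) measurable
  also have "\<dots> = (\<Sum>n. ennreal (a n))"
  proof (intro suminf_cong)
    fix n
    have "(\<integral>\<^sup>+x. ennreal (real n ^ q) * indicator {x. wl x = n} x \<partial>\<mu>)
        = ennreal (real n ^ q) * emeasure \<mu> {x. wl x = n}"
      by (intro nn_integral_cmult_indicator) measurable
    then show "(\<integral>\<^sup>+x. ennreal (real n ^ q) * indicator {x. wl x = n} x \<partial>\<mu>) = ennreal (a n)"
      by (simp add: a_def emeasure_eq_measure ennreal_mult)
  qed
  finally show ?thesis
    using fin by (intro integrableI_nonneg) (auto simp: less_top)
qed

lemma wt_power_integrable: "integrable \<mu> (\<lambda>s. (b + real (wl s)) ^ p)"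
proof -
  have "(\<lambda>s. (b + real (wl s)) ^ p) =
      (\<lambda>s. \<Sum>k\<le>p. of_nat (p choose k) * b ^ k * real (wl s) ^ (p - k))"
    by (simp add: binomial_ring)
  then show ?thesis using moment_integrable by simp
qed

text \<open>For the \<open>p\<close>-th moment, one random step costs no more than a deterministic
  step of length \<open>K\<close>. The cost is additive in \<open>t\<close>, so it iterates to
  \<open>n * K\<close> without inflating the leading constant.\<close>

lemma exists_drift:
  "\<exists>K\<ge>1. \<forall>t\<ge>0. (\<integral>s. (t + real (wl s)) ^ p \<partial>\<mu>) \<le> (t + K) ^ p"
proof -
  define M where "M q = (\<integral>s. real (wl s) ^ q \<partial>\<mu>)" for q
  \<comment> \<open>\<open>K\<close> is at least \<open>1\<close> and dominates each moment up to
    order \<open>p\<close>, so \<open>M q \<le> K \<le> K ^ q\<close> for \<open>q \<ge> 1\<close>;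
    then the binomial expansion is compared termwise.\<close>
  define K where "K = 1 + (\<Sum>q\<le>p. M q)"
  have M0: "M q \<ge> 0" for q by (auto simp: M_def)
  have K1: "K \<ge> 1" using M0 by (auto simp: K_def sum_nonneg)
  have MK: "M q \<le> K ^ q" if "q \<le> p" for q
  proof (cases "q = 0")
    case True
    then show ?thesis using prob_space by (simp add: M_def)
  next
    case False
    have "M q \<le> (\<Sum>q\<le>p. M q)" using M0 that by (intro member_le_sum) auto
    then have "M q \<le> K" by (simp add: K_def)
    also have "K \<le> K ^ q" using K1 False self_le_power by (metis gr0I)
    finally show ?thesis .
  qed
  have "(\<integral>s. (t + real (wl s)) ^ p \<partial>\<mu>) \<le> (t + K) ^ p" if t: "t \<ge> 0" for t
  proof -
    have "(\<integral>s. (t + real (wl s)) ^ p \<partial>\<mu>)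
        = (\<integral>s. (\<Sum>k\<le>p. of_nat (p choose k) * t ^ k * real (wl s) ^ (p - k)) \<partial>\<mu>)"
      by (simp add: binomial_ring)
    also have "\<dots> = (\<Sum>k\<le>p. of_nat (p choose k) * t ^ k * M (p - k))"
      using moment_integrable by (subst Bochner_Integration.integral_sum) (auto simp: M_def)
    also have "\<dots> \<le> (\<Sum>k\<le>p. of_nat (p choose k) * t ^ k * K ^ (p - k))"
      using MK t by (intro sum_mono mult_left_mono) auto
    also have "\<dots> = (t + K) ^ p" by (simp add: binomial_ring)
    finally show ?thesis .
  qed
  then show ?thesis using K1 by blast
qed

section \<open>Functions of polynomial growth\<close>

lemma niceI: "\<phi> \<in> borel_measurable borel \<Longrightarrow> (\<And>x. \<bar>\<phi> x\<bar> \<le> A * wt x ^ p) \<Longrightarrow> nice \<phi>"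
  unfolding nice_def by blast

lemma nice_measurable [measurable_dest]: "nice \<phi> \<Longrightarrow> \<phi> \<in> borel_measurable borel"
  by (simp add: nice_def)

lemma growth_const_nonneg:
  assumes "\<And>x. \<bar>\<phi> x\<bar> \<le> A * wt x ^ p"
  shows "A \<ge> 0"
proof -
  have "wt 0 ^ p > 0" using wt_ge1[of 0] by (intro zero_less_power) linarith
  moreover have "0 \<le> A * wt 0 ^ p" using assms[of 0] by linarith
  ultimately show ?thesis by (simp add: zero_le_mult_iff)
qed

lemma growth_mono:
  assumes "\<And>x. \<bar>\<phi> x\<bar> \<le> A * wt x ^ p" "p \<le> q"
  shows "\<bar>\<phi> x\<bar> \<le> A * wt x ^ q"
proof -
  have "A * wt x ^ p \<le> A * wt x ^ q"
    using growth_const_nonneg[OF assms(1)] wt_ge1[of x] assms(2)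
    by (intro mult_left_mono power_increasing) auto
  with assms(1)[of x] show ?thesis by linarith
qed

lemma nice_add:
  assumes "nice f" "nice g"
  shows "nice (\<lambda>x. f x + g x)"
proof -
  note [measurable] = assms
  obtain A p where A: "\<And>x. \<bar>f x\<bar> \<le> A * wt x ^ p" using assms by (auto simp: nice_def)
  obtain B q where B: "\<And>x. \<bar>g x\<bar> \<le> B * wt x ^ q" using assms by (auto simp: nice_def)
  have "\<bar>f x + g x\<bar> \<le> (A + B) * wt x ^ max p q" for x
    using growth_mono[OF A, of "max p q" x] growth_mono[OF B, of "max p q" x]
    by (simp add: distrib_right)
  then show ?thesis by (intro niceI[of _ "A + B" "max p q"]) measurable
qed

lemma nice_mult:
  assumes "nice f" "nice g"
  shows "nice (\<lambda>x. f x * g x)"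
proof -
  note [measurable] = assms
  obtain A p where A: "\<And>x. \<bar>f x\<bar> \<le> A * wt x ^ p" using assms by (auto simp: nice_def)
  obtain B q where B: "\<And>x. \<bar>g x\<bar> \<le> B * wt x ^ q" using assms by (auto simp: nice_def)
  have "\<bar>f x * g x\<bar> \<le> (A * B) * wt x ^ (p + q)" for x
    using mult_mono[OF A[of x] B[of x]] A[of x]
    by (simp add: abs_mult power_add mult_ac)
  then show ?thesis by (intro niceI[of _ "A * B" "p + q"]) measurable
qed

lemma nice_const: "nice (\<lambda>x. c)"
  by (rule niceI[of _ "\<bar>c\<bar>" 0]) auto

lemma nice_diff: "nice f \<Longrightarrow> nice g \<Longrightarrow> nice (\<lambda>x. f x - g x)"
  using nice_add[of f "\<lambda>x. (-1) * g x"] nice_mult[OF nice_const, of g "-1"] by simp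

lemma nice_power2: "nice f \<Longrightarrow> nice (\<lambda>x. (f x)\<^sup>2)"
  using nice_mult[of f f] by (simp add: power2_eq_square)

lemmas nice_intros = nice_add nice_diff nice_mult nice_const nice_power2

lemma growth_translate:
  assumes "\<And>x. \<bar>f x\<bar> \<le> A * wt x ^ p"
  shows "\<bar>f (u + x)\<bar> \<le> (A * wt u ^ p) * wt x ^ p"
proof -
  have "A * wt (u + x) ^ p \<le> A * (wt u * wt x) ^ p"
    using growth_const_nonneg[OF assms] wt_ge1[of "u + x"] wt_add_le_mult[of u x]
    by (intro mult_left_mono power_mono) auto
  with assms[of "u + x"] show ?thesis by (simp add: power_mult_distrib mult_ac)
qed

lemma nice_translate:
  assumes "nice f"
  shows "nice (\<lambda>x. f (u + x))"
proof -
  obtain A p where A: "\<And>x. \<bar>f x\<bar> \<le> A * wt x ^ p" using assms by (auto simp: nice_def)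
  show ?thesis
    using measurable_translate[of f borel u] growth_translate[OF A] assms
    by (intro niceI[of _ "A * wt u ^ p" p]) (auto simp: nice_def)
qed

lemma nice_integrable:
  assumes "nice f"
  shows "integrable \<mu> (\<lambda>s. f (x + s))"
proof -
  have n: "nice (\<lambda>s. f (x + s))" by (rule nice_translate[OF assms])
  then obtain A p where A: "\<And>s. \<bar>f (x + s)\<bar> \<le> A * wt s ^ p" by (auto simp: nice_def)
  note [measurable] = n
  show ?thesis
  proof (rule Bochner_Integration.integrable_bound)
    show "integrable \<mu> (\<lambda>s. A * wt s ^ p)"
      using wt_power_integrable[of 1 p] by (simp add: wt_def)
    show "AE s in \<mu>. norm (f (x + s)) \<le> norm (A * wt s ^ p)"
      using A by (auto intro: order.trans[OF _ abs_ge_self])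
  qed measurable
qed

text \<open>The density makes \<open>P\<close> smoothing: on a ball the kernel is uniformly continuous, and the
  contribution of its complement is small by a Markov-type bound.\<close>

lemma continuous_P:
  assumes "nice \<phi>"
  shows "continuous_on UNIV (P \<phi>)"
proof -
  note [measurable] = assms
  obtain A p where A: "\<And>x. \<bar>\<phi> x\<bar> \<le> A * wt x ^ p" using assms by (auto simp: nice_def)
  note A0 = growth_const_nonneg[OF A]
  obtain K where K: "K \<ge> 1" "\<And>t. t \<ge> 0 \<Longrightarrow> (\<integral>s. (t + real (wl s)) ^ Suc p \<partial>\<mu>) \<le> (t + K) ^ Suc p"
    using exists_drift by blast
  obtain V0 where V0: "open V0" "0 \<in> V0" "\<And>x. x \<in> V0 \<Longrightarrow> wl x \<le> 2" using wl_le2_nhd by blast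
  have "\<forall>\<^sub>F x in nhds x0. dist (P \<phi> x) (P \<phi> x0) < e" if e: "e > 0" for x0 e
  proof -
    \<comment> \<open>\<open>D / R\<close> will bound the part beyond radius \<open>R\<close>,
      uniformly over base points of length at most \<open>wl x0 + 2\<close>; one extra power of the
      weight pays for the factor \<open>1 / R\<close>.\<close>
    define D where "D = A * (wt x0 + 2 + K) ^ Suc p"
    have D0: "D \<ge> 0" using A0 K wt_ge1[of x0] by (auto simp: D_def)
    obtain R where R: "real R > 3 * (D + 1) / e" using reals_Archimedean2 by blast
    define B where "B = {x. wl x \<le> R}"
    have B [measurable]: "B \<in> sets borel" by (simp add: B_def)
    have compact_B: "compact B" by (simp add: B_def wl_le_iff compact_set_pow S_facts)
    define \<phi>1 where "\<phi>1 x = indicator B x * \<phi> x" for x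
    define \<phi>2 where "\<phi>2 x = indicator (- B) x * \<phi> x" for x
    have nice1: "nice \<phi>1"
    proof (rule niceI)
      show "\<phi>1 \<in> borel_measurable borel" unfolding \<phi>1_def by measurable
      show "\<bar>\<phi>1 x\<bar> \<le> A * wt x ^ p" for x
        using A[of x] by (auto simp: \<phi>1_def indicator_def)
    qed
    have nice2: "nice \<phi>2"
    proof (rule niceI)
      show "\<phi>2 \<in> borel_measurable borel" unfolding \<phi>2_def by measurable
      show "\<bar>\<phi>2 x\<bar> \<le> A * wt x ^ p" for x
        using A[of x] by (auto simp: \<phi>2_def indicator_def)
    qed
    have P_split: "P \<phi> x = P \<phi>1 x + P \<phi>2 x" for x
    proof -
      have "\<phi> = (\<lambda>x. \<phi>1 x + \<phi>2 x)" by (auto simp: \<phi>1_def \<phi>2_def indicator_def)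
      then have "P \<phi> x = (\<integral>s. \<phi>1 (x + s) + \<phi>2 (x + s) \<partial>\<mu>)" by (simp add: P_def)
      then show ?thesis
        using nice_integrable[OF nice1] nice_integrable[OF nice2] by (simp add: P_def)
    qed
    have tail: "\<bar>P \<phi>2 x\<bar> \<le> e / 3" if "wl x \<le> wl x0 + 2" for x
    proof -
      have pt: "\<bar>\<phi>2 y\<bar> \<le> A / real R * wt y ^ Suc p" for y
      proof (cases "y \<in> B")
        case True
        then show ?thesis using A0 wt_ge1[of y] by (simp add: \<phi>2_def)
      next
        case False
        have Rp: "real R > 0" using R D0 e by (smt (verit) divide_pos_pos mult_pos_pos)
        have "A * wt y ^ p * 1 \<le> A * wt y ^ p * (wt y / real R)"
          using False A0 wt_ge1[of y] Rp
          by (intro mult_left_mono) (auto simp: B_def wt_def field_simps)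
        then show ?thesis using A[of y] False by (simp add: \<phi>2_def field_simps)
      qed
      have "\<bar>P \<phi>2 x\<bar> \<le> (\<integral>s. \<bar>\<phi>2 (x + s)\<bar> \<partial>\<mu>)"
        unfolding P_def by (rule integral_abs_bound)
      also have "\<dots> \<le> (\<integral>s. A / real R * (wt x0 + 2 + real (wl s)) ^ Suc p \<partial>\<mu>)"
      proof (rule integral_mono)
        show "integrable \<mu> (\<lambda>s. \<bar>\<phi>2 (x + s)\<bar>)" by (intro integrable_abs nice_integrable nice2)
        show "integrable \<mu> (\<lambda>s. A / real R * (wt x0 + 2 + real (wl s)) ^ Suc p)"
          using wt_power_integrable[of "wt x0 + 2" "Suc p"] by simp
        fix s
        have "wt (x + s) \<le> wt x0 + 2 + real (wl s)"
          using wt_add_le[of x s] that by (simp add: wt_def)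
        then have "A / real R * wt (x + s) ^ Suc p \<le> A / real R * (wt x0 + 2 + real (wl s)) ^ Suc p"
          using A0 wt_ge1[of "x + s"] by (intro mult_left_mono power_mono) auto
        then show "\<bar>\<phi>2 (x + s)\<bar> \<le> A / real R * (wt x0 + 2 + real (wl s)) ^ Suc p"
          using pt[of "x + s"] by linarith
      qed
      also have "\<dots> = A / real R * (\<integral>s. (wt x0 + 2 + real (wl s)) ^ Suc p \<partial>\<mu>)" by simp
      also have "\<dots> \<le> A / real R * (wt x0 + 2 + K) ^ Suc p"
        using K(2)[of "wt x0 + 2"] A0 wt_ge1[of x0] by (intro mult_left_mono) auto
      also have "\<dots> = D / real R" by (simp add: D_def)
      also have "\<dots> \<le> e / 3"
      proof -
        have Rp: "real R > 0" using R D0 e by (smt (verit) divide_pos_pos mult_pos_pos)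
        have "3 * (D + 1) < e * real R" using R e by (simp add: field_simps)
        then show ?thesis using Rp by (simp add: field_simps)
      qed
      finally show ?thesis .
    qed
    \<comment> \<open>Without the \<open>1\<close> this bounds the integral of the absolute value of
      \<open>\<phi>1\<close>; the \<open>1\<close> makes \<open>C\<close> positive, so that
      \<open>d = e / (3 * C)\<close> is a valid kernel tolerance.\<close>
    define C where "C = A * (1 + real R) ^ p * measure m B + 1"
    have C0: "C > 0" using A0 by (auto simp: C_def intro!: add_nonneg_pos)
    have mB: "emeasure m B < \<infinity>" by (rule emeasure_compact[OF compact_B])
    \<comment> \<open>Left invariance moves the base point out of the possibly discontinuous
      \<open>\<phi>1\<close> into the continuous density.\<close>
    have P1: "P \<phi>1 x = (\<integral>t. h (- x + t) * \<phi>1 t \<partial>m)"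
         and P1i: "integrable m (\<lambda>t. h (- x + t) * \<phi>1 t)" for x
    proof -
      note [measurable] = nice1
      have m1 [measurable]: "(\<lambda>s. \<phi>1 (x + s)) \<in> borel_measurable borel"
        by (rule nice_measurable[OF nice_translate[OF nice1]])
      have m2 [measurable]: "(\<lambda>s. h (- x + s)) \<in> borel_measurable borel"
        by (rule measurable_translate) measurable
      have eq: "\<phi>1 (x + (- x + t)) = \<phi>1 t" for t by (simp add: add.assoc[symmetric])
      have "P \<phi>1 x = (\<integral>s. h s * \<phi>1 (x + s) \<partial>m)"
        unfolding P_def by (subst mu_density, subst integral_density) (auto simp: h_nonneg)
      also have "\<dots> = (\<integral>t. h (- x + t) * \<phi>1 (x + (- x + t)) \<partial>m)"
        by (rule integral_translate[symmetric]) measurable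
      finally show "P \<phi>1 x = (\<integral>t. h (- x + t) * \<phi>1 t \<partial>m)" by (simp only: eq)
      have "integrable \<mu> (\<lambda>s. \<phi>1 (x + s))" by (rule nice_integrable[OF nice1])
      then have "integrable m (\<lambda>s. h s * \<phi>1 (x + s))"
        by (subst (asm) mu_density, subst (asm) integrable_density) (auto simp: h_nonneg)
      then have "integrable (distr m borel (\<lambda>y. - x + y)) (\<lambda>s. h s * \<phi>1 (x + s))"
        by (simp only: distr_translate)
      then have "integrable m (\<lambda>t. h (- x + t) * \<phi>1 (x + (- x + t)))"
        by (subst (asm) integrable_distr_eq) auto
      then show "integrable m (\<lambda>t. h (- x + t) * \<phi>1 t)" by (simp only: eq)
    qed
    define d where "d = e / (3 * C)"
    have d: "d > 0" using e C0 by (simp add: d_def)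
    let ?F = "\<lambda>p::'a \<times> 'a. h (- fst p + snd p) - h (- x0 + snd p)"
    let ?W = "?F -` {-d<..<d}"
    have "continuous_on UNIV ?F"
      by (intro continuous_intros continuous_on_compose2[OF h_cont]) auto
    then have W: "open ?W" by (intro open_vimage) auto
    have "{x0} \<times> B \<subseteq> ?W" using d by auto
    from Elementary_Topology.tube_lemma[OF compact_B W this]
    obtain V1 where V1: "x0 \<in> V1" "open V1" "V1 \<times> B \<subseteq> ?W" by (elim exE conjE)
    \<comment> \<open>\<open>V1\<close> controls the kernel uniformly on \<open>B\<close>; the
      translate of \<open>V0\<close> keeps lengths within the range of the tail bound.\<close>
    let ?V = "V1 \<inter> (\<lambda>x. - x0 + x) -` V0"
    have "open ?V" by (intro open_Int V1 open_vimage V0 continuous_intros)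
    moreover have "x0 \<in> ?V" using V1 V0 by simp
    moreover have "dist (P \<phi> x) (P \<phi> x0) < e" if x: "x \<in> ?V" for x
    proof -
      have "wl (x0 + (- x0 + x)) \<le> wl x0 + 2"
        using wl_add[of x0 "- x0 + x"] V0(3)[of "- x0 + x"] x by simp
      then have wx: "wl x \<le> wl x0 + 2" by (simp add: add.assoc[symmetric])
      have "P \<phi>1 x - P \<phi>1 x0 = (\<integral>t. h (- x + t) * \<phi>1 t - h (- x0 + t) * \<phi>1 t \<partial>m)"
        unfolding P1 by (rule Bochner_Integration.integral_diff[symmetric]) (rule P1i)+
      also have "norm \<dots> \<le> (\<integral>t. d * (A * (1 + real R) ^ p) * indicator B t \<partial>m)"
      proof (rule order.trans[OF integral_norm_bound integral_mono])
        show "integrable m (\<lambda>t. norm (h (- x + t) * \<phi>1 t - h (- x0 + t) * \<phi>1 t))"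
          by (intro integrable_norm Bochner_Integration.integrable_diff P1i)
        show "integrable m (\<lambda>t. d * (A * (1 + real R) ^ p) * indicator B t)"
          using mB by (intro integrable_mult_right integrable_real_indicator) (auto simp: sets_m)
        fix t
        show "norm (h (- x + t) * \<phi>1 t - h (- x0 + t) * \<phi>1 t)
            \<le> d * (A * (1 + real R) ^ p) * indicator B t"
        proof (cases "t \<in> B")
          case True
          then have "(x, t) \<in> ?W" using V1(3) x by blast
          then have 1: "\<bar>h (- x + t) - h (- x0 + t)\<bar> \<le> d" by auto
          have "A * wt t ^ p \<le> A * (1 + real R) ^ p"
            using True A0 by (intro mult_left_mono power_mono) (auto simp: B_def wt_def)
          then have 2: "\<bar>\<phi>1 t\<bar> \<le> A * (1 + real R) ^ p" using A[of t] True by (simp add: \<phi>1_def)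
          have "norm (h (- x + t) * \<phi>1 t - h (- x0 + t) * \<phi>1 t)
             = \<bar>h (- x + t) - h (- x0 + t)\<bar> * \<bar>\<phi>1 t\<bar>"
            by (simp add: left_diff_distrib[symmetric] abs_mult)
          also have "\<dots> \<le> d * (A * (1 + real R) ^ p)"
            using 1 2 d by (intro mult_mono) auto
          finally show ?thesis using True by simp
        qed (simp add: \<phi>1_def)
      qed
      also have "\<dots> = d * (A * (1 + real R) ^ p * measure m B)"
        using mB by (simp add: less_top)
      also have "\<dots> < d * C" using d by (simp add: C_def)
      also have "\<dots> = e / 3" using C0 by (simp add: d_def)
      finally have "\<bar>P \<phi>1 x - P \<phi>1 x0\<bar> < e / 3" by simp
      moreover have "\<bar>P \<phi>2 x\<bar> \<le> e / 3" "\<bar>P \<phi>2 x0\<bar> \<le> e / 3" using tail wx by auto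
      ultimately show ?thesis unfolding P_split dist_real_def by linarith
    qed
    ultimately show ?thesis unfolding eventually_nhds by blast
  qed
  then have "\<And>x0. (P \<phi> \<longlongrightarrow> P \<phi> x0) (nhds x0)" by (auto intro: tendstoI)
  then show ?thesis
    by (simp add: continuous_on_def tendsto_at_iff_tendsto_nhds)
qed

end

subsection \<open>Spreading of the random walk\<close>

text \<open>The nonempty words in \<open>H\<close> form an open semigroup inside \<open>T\<close>.
  The elements of it whose inverses also lie in it form an open subgroup, which contains
  \<open>0\<close> because \<open>y\<close> and \<open>- y\<close> are both generators. Open
  subgroups are closed by their cosets, so connectedness leaves only the whole group.\<close>

lemma open_semigroup_UNIV:
  fixes H :: "'a::topological_group_add set"
  assumes "connected (UNIV :: 'a set)" "open H" "y \<in> H" "- y \<in> H"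
    and T: "H \<subseteq> T" "\<And>u a. u \<in> T \<Longrightarrow> a \<in> H \<Longrightarrow> u + a \<in> T"
  shows "T = UNIV"
proof -
  have one: "set_pow H (Suc 0) = H" by auto
  \<comment> \<open>Exponents start at one, because the empty word \<open>0\<close> is not known to
    lie in \<open>T\<close> beforehand.\<close>
  define G where "G = (\<Union>n. set_pow H (Suc n))"
  have "set_pow H (Suc n) \<subseteq> T" for n
  proof (induction n)
    case 0
    then show ?case using T(1) one by simp
  next
    case (Suc n)
    show ?case
    proof
      fix z assume "z \<in> set_pow H (Suc (Suc n))"
      then obtain x s where "z = x + s" "x \<in> set_pow H (Suc n)" "s \<in> H"
        by (simp only: set_pow.simps(2)[of H "Suc n"] mem_Collect_eq) blast
      then show "z \<in> T" using Suc T(2) by blast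
    qed
  qed
  then have GT: "G \<subseteq> T" by (auto simp: G_def)
  have G_add: "a + b \<in> G" if "a \<in> G" "b \<in> G" for a b
  proof -
    from that obtain i j where "a \<in> set_pow H (Suc i)" "b \<in> set_pow H (Suc j)"
      unfolding G_def by blast
    then have "a + b \<in> set_pow H (Suc (Suc i + j))"
      using set_pow_add[of a H "Suc i" b "Suc j"] by simp
    then show ?thesis unfolding G_def by blast
  qed
  have translate_open: "open ((\<lambda>y. x + y) ` U)" if "open U" for x :: 'a and U
  proof -
    have z: "z = x + (- x + z)" for z :: 'a by (simp add: add.assoc[symmetric])
    have "(\<lambda>y. x + y) ` U = (\<lambda>y. - x + y) -` U"
      using z by (auto simp: add.assoc[symmetric] intro!: image_eqI)
    then show ?thesis using that by (auto intro!: open_vimage continuous_intros)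
  qed
  have "set_pow H (Suc n) = (\<Union>x\<in>set_pow H n. (\<lambda>y. x + y) ` H)" for n by auto
  then have "open (set_pow H (Suc n))" for n
    using translate_open[OF assms(2)] by (simp only:) blast
  then have G_open: "open G" unfolding G_def by blast
  define N where "N = G \<inter> uminus -` G"
  have N_open: "open N" unfolding N_def by (intro open_Int G_open open_vimage continuous_intros)
  have H_G: "H \<subseteq> G" using one unfolding G_def by blast
  have "y + - y \<in> G" "- (y + - y) \<in> G"
    using G_add[of y "- y"] H_G assms(3,4) by auto
  then have N0: "0 \<in> N" by (simp add: N_def)
  have N_add: "a + b \<in> N" if "a \<in> N" "b \<in> N" for a b
    using that G_add[of a b] G_add[of "- b" "- a"] by (simp add: N_def minus_add)
  have N_minus: "- a \<in> N" if "a \<in> N" for a using that by (auto simp: N_def)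
  have "open (- N)"
  proof (subst open_subopen, safe)
    fix x assume x: "x \<notin> N"
    have "x + a \<notin> N" if "a \<in> N" for a
    proof
      assume "x + a \<in> N"
      then have "x + a + - a \<in> N" using N_add N_minus that by blast
      then show False using x by (simp add: add.assoc)
    qed
    then have "(\<lambda>y. x + y) ` N \<subseteq> - N" by auto
    moreover have "x \<in> (\<lambda>y. x + y) ` N" using N0 by (auto intro: image_eqI[of _ _ 0])
    ultimately show "\<exists>T. open T \<and> x \<in> T \<and> T \<subseteq> - N" using translate_open[OF N_open] by blast
  qed
  then have "N = UNIV"
    using connectedD[OF assms(1) N_open, of "- N"] N0 by auto
  then show ?thesis using GT by (auto simp: N_def)
qed

section \<open>Iterates of the Markov operator, second moments and domination of Haar
  measure\<close>

context courteous_walk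
begin

text \<open>Each application of \<open>P\<close> only adds \<open>K\<close> to the offset
  \<open>b\<close> and leaves \<open>A\<close> unchanged, which is what makes the bound for
  \<open>n\<close> steps polynomial in \<open>n\<close>.\<close>

lemma P_bound:
  assumes f: "nice f" "\<And>x. \<bar>f x\<bar> \<le> A * (wt x + b) ^ p" and "A \<ge> 0" "b \<ge> 0"
    and K: "\<And>t. t \<ge> 0 \<Longrightarrow> (\<integral>s. (t + real (wl s)) ^ p \<partial>\<mu>) \<le> (t + K) ^ p"
  shows "\<bar>P f x\<bar> \<le> A * (wt x + (b + K)) ^ p"
proof -
  have "\<bar>P f x\<bar> \<le> (\<integral>s. \<bar>f (x + s)\<bar> \<partial>\<mu>)"
    unfolding P_def by (rule integral_abs_bound)
  also have "\<dots> \<le> (\<integral>s. A * (wt x + b + real (wl s)) ^ p \<partial>\<mu>)"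
  proof (rule integral_mono)
    show "integrable \<mu> (\<lambda>s. \<bar>f (x + s)\<bar>)" by (intro integrable_abs nice_integrable f)
    show "integrable \<mu> (\<lambda>s. A * (wt x + b + real (wl s)) ^ p)"
      using wt_power_integrable[of "wt x + b" p] by simp
    fix s
    have "A * (wt (x + s) + b) ^ p \<le> A * (wt x + b + real (wl s)) ^ p"
      using wt_add_le[of x s] wt_ge1[of "x + s"] assms(3,4) by (intro mult_left_mono power_mono) auto
    then show "\<bar>f (x + s)\<bar> \<le> A * (wt x + b + real (wl s)) ^ p"
      using f(2)[of "x + s"] by linarith
  qed
  also have "\<dots> = A * (\<integral>s. (wt x + b + real (wl s)) ^ p \<partial>\<mu>)" by simp
  also have "\<dots> \<le> A * (wt x + b + K) ^ p"
    using K[of "wt x + b"] wt_ge1[of x] assms(3,4) by (intro mult_left_mono) auto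
  finally show ?thesis by (simp add: add.assoc)
qed

lemma nice_P:
  assumes "nice f"
  shows "nice (P f)"
proof -
  obtain A p where A: "\<And>x. \<bar>f x\<bar> \<le> A * wt x ^ p" using assms by (auto simp: nice_def)
  note A0 = growth_const_nonneg[OF A]
  obtain K where K: "K \<ge> 1" "\<And>t. t \<ge> 0 \<Longrightarrow> (\<integral>s. (t + real (wl s)) ^ p \<partial>\<mu>) \<le> (t + K) ^ p"
    using exists_drift by blast
  show ?thesis
  proof (rule niceI)
    show "P f \<in> borel_measurable borel"
      by (intro borel_measurable_continuous_onI continuous_P assms)
    fix x
    have "\<bar>P f x\<bar> \<le> A * (wt x + (0 + K)) ^ p"
      using A A0 K by (intro P_bound assms) auto
    also have "\<dots> \<le> A * ((1 + K) * wt x) ^ p"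
      using A0 K wt_ge1[of x] mult_left_mono[of 1 "wt x" K]
      by (intro mult_left_mono power_mono) (auto simp: algebra_simps)
    finally show "\<bar>P f x\<bar> \<le> A * (1 + K) ^ p * wt x ^ p" by (simp add: power_mult_distrib mult_ac)
  qed
qed

abbreviation Pn :: "nat \<Rightarrow> ('a \<Rightarrow> real) \<Rightarrow> 'a \<Rightarrow> real" where "Pn n \<equiv> P ^^ n"

lemma nice_Pn: "nice f \<Longrightarrow> nice (Pn n f)"
  by (induction n) (auto intro: nice_P)

lemma Pn_growth:
  assumes "nice f" "\<And>x. \<bar>f x\<bar> \<le> A * wt x ^ p"
  shows "\<exists>K\<ge>1. \<forall>n x. \<bar>Pn n f x\<bar> \<le> A * (wt x + real n * K) ^ p"
proof -
  obtain K where K: "K \<ge> 1" "\<And>t. t \<ge> 0 \<Longrightarrow> (\<integral>s. (t + real (wl s)) ^ p \<partial>\<mu>) \<le> (t + K) ^ p"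
    using exists_drift by blast
  have "\<forall>x. \<bar>Pn n f x\<bar> \<le> A * (wt x + real n * K) ^ p" for n
  proof (induction n)
    case (Suc n)
    have "\<bar>P (Pn n f) x\<bar> \<le> A * (wt x + (real n * K + K)) ^ p" for x
      using Suc K growth_const_nonneg[OF assms(2)] by (intro P_bound nice_Pn assms) auto
    then show ?case by (simp add: algebra_simps)
  qed (use assms in simp)
  then show ?thesis using K(1) by blast
qed

lemma P_mono: "nice f \<Longrightarrow> nice g \<Longrightarrow> (\<And>x. f x \<le> g x) \<Longrightarrow> P f x \<le> P g x"
  unfolding P_def by (intro integral_mono nice_integrable)

lemma Pn_mono:
  assumes "nice f" "nice g" "\<And>x. f x \<le> g x"
  shows "Pn n f x \<le> Pn n g x"
  by (induction n arbitrary: x) (use assms in \<open>auto intro: P_mono nice_Pn\<close>)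

lemma P_add: "nice f \<Longrightarrow> nice g \<Longrightarrow> P (\<lambda>x. f x + g x) = (\<lambda>x. P f x + P g x)"
  by (simp add: P_def nice_integrable fun_eq_iff)

lemma Pn_add:
  assumes "nice f" "nice g"
  shows "Pn n (\<lambda>x. f x + g x) = (\<lambda>x. Pn n f x + Pn n g x)"
  by (induction n) (simp_all add: P_add nice_Pn assms)

lemma Pn_cmult: "Pn n (\<lambda>x. c * f x) = (\<lambda>x. c * Pn n f x)"
  by (induction n) (auto simp: P_def)

lemma Pn_const: "Pn n (\<lambda>x. c) = (\<lambda>x. c)"
  using prob_space by (induction n) (auto simp: P_def)

lemma Pn_diff:
  assumes "nice f" "nice g"
  shows "Pn n (\<lambda>x. f x - g x) = (\<lambda>x. Pn n f x - Pn n g x)"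
  using Pn_add[OF assms(1) nice_mult[OF nice_const assms(2)], of n "-1"] Pn_cmult[of n "-1" g] by simp

lemma Pn_translate: "Pn n (\<lambda>x. f (u + x)) = (\<lambda>x. Pn n f (u + x))"
  by (induction n) (auto simp: P_def add.assoc)

lemma Pn_fixed: "P f = f \<Longrightarrow> Pn n f = f"
  by (induction n) auto

lemma Pn_Pn: "Pn i (Pn j f) = Pn (i + j) f"
  by (simp add: funpow_add)

text \<open>Martingale orthogonality: in the expanded square, the mean of the cross term is computed
  from the fixed-point property.\<close>

lemma Pn_variance:
  assumes "nice f" "P f = f"
  shows "Pn n (\<lambda>s. (f (x + s) - f x)\<^sup>2) 0 = Pn n (\<lambda>s. (f s)\<^sup>2) x - (f x)\<^sup>2"
proof -
  have n: "nice (\<lambda>s. f (x + s))" by (rule nice_translate[OF assms(1)])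
  have "(\<lambda>s. (f (x + s) - f x)\<^sup>2) = (\<lambda>s. ((f (x + s))\<^sup>2 - (2 * f x) * f (x + s)) + (f x)\<^sup>2)"
    by (auto simp: power2_eq_square algebra_simps)
  then have "Pn n (\<lambda>s. (f (x + s) - f x)\<^sup>2) 0 =
      Pn n (\<lambda>s. (f (x + s))\<^sup>2) 0 - (2 * f x) * Pn n (\<lambda>s. f (x + s)) 0 + (f x)\<^sup>2"
    using n by (simp add: Pn_add Pn_diff Pn_cmult Pn_const nice_intros)
  also have "Pn n (\<lambda>s. (f (x + s))\<^sup>2) 0 = Pn n (\<lambda>s. (f s)\<^sup>2) x"
    using Pn_translate[of n "\<lambda>s. (f s)\<^sup>2" x] by simp
  also have "Pn n (\<lambda>s. f (x + s)) 0 = f x"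
    using Pn_translate[of n f x] Pn_fixed[OF assms(2)] by simp
  finally show ?thesis by (simp add: power2_eq_square)
qed

lemma Pn_nonneg:
  assumes "\<And>x. 0 \<le> f x"
  shows "0 \<le> Pn n f x"
proof (induction n arbitrary: x)
  case (Suc n)
  then show ?case by (simp add: P_def)
qed (use assms in simp)

text \<open>Variances are nonnegative, so \<open>f\<^sup>2\<close> is subharmonic over
  \<open>j - i\<close> steps; the positive operator \<open>Pn i\<close> preserves the
  inequality.\<close>

lemma Pn_square_mono:
  assumes "nice f" "P f = f" "i \<le> j"
  shows "Pn i (\<lambda>s. (f s)\<^sup>2) x \<le> Pn j (\<lambda>s. (f s)\<^sup>2) x"
proof -
  let ?q = "\<lambda>s. (f s)\<^sup>2"
  have "?q y \<le> Pn (j - i) ?q y" for y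
    using Pn_variance[OF assms(1,2), of "j - i" y] Pn_nonneg[of "\<lambda>s. (f (y + s) - f y)\<^sup>2" "j - i" 0]
    by simp
  then have "Pn i ?q x \<le> Pn i (Pn (j - i) ?q) x"
    by (intro Pn_mono nice_Pn nice_intros assms(1))
  then show ?thesis using assms(3) by (simp add: Pn_Pn)
qed

text \<open>Otherwise finitely many null translates of \<open>V\<close> would cover the compact set
  \<open>S\<close>, which has measure \<open>1\<close>.\<close>

lemma emeasure_open_pos:
  assumes "open V" "V \<noteq> {}"
  shows "emeasure m V > 0"
proof (rule ccontr)
  assume "\<not> emeasure m V > 0"
  then have V0: "emeasure m V = 0" by simp
  obtain v where v: "v \<in> V" using assms by blast
  define U where "U x = (\<lambda>y. (x + - v) + y) ` V" for x
  have U_open: "open (U x)" for x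
    unfolding U_def translate_image_eq by (intro open_vimage assms continuous_intros)
  have U_null: "emeasure m (U x) = 0" for x
    unfolding U_def using V0 assms by (subst emeasure_translate) auto
  have x_in: "x \<in> U x" for x
    using v by (auto simp: U_def add.assoc intro!: image_eqI[of _ _ v])
  obtain C where C: "C \<subseteq> S" "finite C" "S \<subseteq> (\<Union>x\<in>C. U x)"
    using compactE_image[OF S_facts(1), of S U] U_open x_in by blast
  have "emeasure m S \<le> emeasure m (\<Union>x\<in>C. U x)"
    using C U_open by (intro emeasure_mono) (auto simp: sets_m)
  also have "\<dots> \<le> (\<Sum>x\<in>C. emeasure m (U x))"
    using C U_open by (intro emeasure_subadditive_finite) (auto simp: sets_m)
  finally show False using haar(2) U_null by simp
qed

lemma open_measure_lower:
  assumes "open V" "V \<noteq> {}"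
  shows "\<exists>v>0. ennreal v \<le> emeasure m V"
proof (cases "emeasure m V")
  case (real r)
  then show ?thesis using emeasure_open_pos[OF assms] by (auto intro!: exI[of _ r])
next
  case top
  then show ?thesis by (auto intro!: exI[of _ 1])
qed

lemma nn_integral_P:
  assumes "nice \<phi>" "\<And>x. \<phi> x \<ge> 0"
  shows "(\<integral>\<^sup>+s. ennreal (h s * \<phi> (x + s)) \<partial>m) = ennreal (P \<phi> x)"
proof -
  have m1 [measurable]: "(\<lambda>s. \<phi> (x + s)) \<in> borel_measurable borel"
    by (rule nice_measurable[OF nice_translate[OF assms(1)]])
  have "ennreal (P \<phi> x) = (\<integral>\<^sup>+s. ennreal (\<phi> (x + s)) \<partial>\<mu>)"
    unfolding P_def using assms by (intro nn_integral_eq_integral[symmetric] nice_integrable) auto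
  also have "\<dots> = (\<integral>\<^sup>+s. ennreal (h s) * ennreal (\<phi> (x + s)) \<partial>m)"
    by (subst mu_density, subst nn_integral_density) auto
  finally show ?thesis by (simp add: ennreal_mult' h_nonneg)
qed

text \<open>\<open>spread u\<close>: some convolution power of \<open>\<mu>\<close> dominates a multiple of Haar measure near \<open>u\<close>.\<close>

definition spread :: "'a \<Rightarrow> bool" where
  "spread u \<longleftrightarrow> (\<exists>C\<ge>0. \<exists>j V. open V \<and> 0 \<in> V \<and> (\<forall>\<phi>. nice \<phi> \<longrightarrow> (\<forall>x. 0 \<le> \<phi> x) \<longrightarrow>
     (\<integral>\<^sup>+s. ennreal (\<phi> (u + s)) * indicator V s \<partial>m) \<le> ennreal (C * Pn j \<phi> 0)))"

text \<open>Where the density exceeds \<open>h a / 2\<close>, Haar measure is at most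
  \<open>2 / h a\<close> times \<open>\<mu>\<close>; left invariance recentres this region at
  \<open>a\<close>.\<close>

lemma spread_one_step:
  assumes a: "h a > 0" and \<phi>: "nice \<phi>" "\<And>x. 0 \<le> \<phi> x"
  shows "(\<integral>\<^sup>+s. ennreal (\<phi> (y + (a + s))) * indicator {s. h a / 2 < h (a + s)} s \<partial>m)
     \<le> ennreal (2 / h a * P \<phi> y)"
proof -
  have m1 [measurable]: "(\<lambda>s. \<phi> (y + s)) \<in> borel_measurable borel"
    by (rule nice_measurable[OF nice_translate[OF \<phi>(1)]])
  have "(\<integral>\<^sup>+s. ennreal (\<phi> (y + (a + s))) * indicator {s. h a / 2 < h (a + s)} s \<partial>m)
     \<le> (\<integral>\<^sup>+s. ennreal (2 / h a) * ennreal (h (a + s) * \<phi> (y + (a + s))) \<partial>m)"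
  proof (rule nn_integral_mono)
    fix s
    show "ennreal (\<phi> (y + (a + s))) * indicator {s. h a / 2 < h (a + s)} s \<le>
      ennreal (2 / h a) * ennreal (h (a + s) * \<phi> (y + (a + s)))"
    proof (cases "h a / 2 < h (a + s)")
      case True
      then have "1 \<le> 2 / h a * h (a + s)" using a by (simp add: field_simps)
      then have "1 * \<phi> (y + (a + s)) \<le> 2 / h a * h (a + s) * \<phi> (y + (a + s))"
        by (intro mult_right_mono \<phi>)
      then show ?thesis using True a by (simp add: ennreal_mult''[symmetric] mult.assoc h_nonneg \<phi>)
    qed simp
  qed
  also have "\<dots> = (\<integral>\<^sup>+s. ennreal (2 / h a) * ennreal (h s * \<phi> (y + s)) \<partial>m)"
    by (rule nn_integral_translate[of "\<lambda>s. ennreal (2 / h a) * ennreal (h s * \<phi> (y + s))"]) measurable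
  also have "\<dots> = ennreal (2 / h a) * ennreal (P \<phi> y)"
    by (subst nn_integral_cmult) (auto simp: nn_integral_P[OF \<phi>])
  also have "\<dots> = ennreal (2 / h a * P \<phi> y)" using a by (simp only: ennreal_mult'[symmetric] divide_nonneg_pos zero_le_numeral)
  finally show ?thesis .
qed

lemma open_h_ball: "open {s. c < h (a + s)}"
  by (intro open_Collect_less continuous_intros continuous_on_compose2[OF h_cont]) auto

lemma spread_base:
  assumes "h a > 0"
  shows "spread a"
proof -
  have "(\<integral>\<^sup>+s. ennreal (\<phi> (a + s)) * indicator {s. h a / 2 < h (a + s)} s \<partial>m)
      \<le> ennreal (2 / h a * Pn (Suc 0) \<phi> 0)" if "nice \<phi>" "\<forall>x. 0 \<le> \<phi> x" for \<phi>
    using spread_one_step[OF assms that(1), of 0] that(2) by simp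
  then show ?thesis
    unfolding spread_def using assms open_h_ball[of "h a / 2" a]
    by (intro exI[of _ "2 / h a"] exI[of _ "Suc 0"] exI[of _ "{s. h a / 2 < h (a + s)}"] conjI) auto
qed

text \<open>After \<open>j\<close> steps the walk covers a neighbourhood of \<open>u\<close>. From
  every point near \<open>u\<close>, one more step covers one and the same neighbourhood of
  \<open>u + a\<close>, and averaging over these points combines the two bounds.\<close>

lemma spread_step:
  assumes "spread u" and a: "h a > 0"
  shows "spread (u + a)"
proof -
  obtain C j V where C: "C \<ge> 0" and V: "open V" "0 \<in> V"
    and spr: "\<And>\<phi>. nice \<phi> \<Longrightarrow> (\<And>x. 0 \<le> \<phi> x) \<Longrightarrow>
     (\<integral>\<^sup>+s. ennreal (\<phi> (u + s)) * indicator V s \<partial>m) \<le> ennreal (C * Pn j \<phi> 0)"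
    using assms(1) unfolding spread_def by meson
  let ?W = "{s. h a / 2 < h (a + s)}"
  \<comment> \<open>From \<open>u + s\<close>, the increment leading to \<open>u + a + t\<close> is
    \<open>a + (- a + - s + a + t)\<close>. The bracket is \<open>?F (s, t)\<close>, which stays in
    \<open>?W\<close> for \<open>s\<close> and \<open>t\<close> near \<open>0\<close>.\<close>
  let ?F = "\<lambda>p::'a \<times> 'a. - a + - fst p + a + snd p"
  have "open (?F -` ?W)" by (intro open_vimage open_h_ball continuous_intros)
  moreover have "(0, 0) \<in> ?F -` ?W" using a by simp
  ultimately obtain V1 W1 where W1: "open V1" "open W1" "(0, 0) \<in> V1 \<times> W1" "V1 \<times> W1 \<subseteq> ?F -` ?W"
    by (rule open_prod_elim)
  let ?V = "V \<inter> V1"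
  have "open ?V" "?V \<noteq> {}" using V W1 by auto
  then obtain v where v: "v > 0" "ennreal v \<le> emeasure m ?V" using open_measure_lower by blast
  define k where "k = v * (h a / 2)"
  have k: "k > 0" using v a by (simp add: k_def)
  have "(\<integral>\<^sup>+s. ennreal (\<phi> (u + a + s)) * indicator W1 s \<partial>m) \<le> ennreal (C / k * Pn (Suc j) \<phi> 0)"
    if \<phi>: "nice \<phi>" "\<forall>x. 0 \<le> \<phi> x" for \<phi>
  proof -
    let ?I = "\<integral>\<^sup>+t. ennreal (\<phi> (u + a + t)) * indicator W1 t \<partial>m"
    have Ps: "ennreal (h a / 2) * ?I \<le> ennreal (P \<phi> (u + s))" if s: "s \<in> ?V" for s
    proof -
      let ?g = "\<lambda>t. ennreal (\<phi> (u + s + (a + t))) * indicator ?W t"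
      have [measurable]: "?W \<in> sets borel" using open_h_ball by simp
      have m1 [measurable]: "(\<lambda>t. \<phi> (u + s + (a + t))) \<in> borel_measurable borel"
        using nice_measurable[OF nice_translate[OF \<phi>(1), of "u + s + a"]] by (simp add: add.assoc)
      have eq: "u + s + (a + (- a + - s + a + t)) = u + a + t" for t
      proof -
        have "u + s + (a + (- a + - s + a + t)) = u + (s + ((a + - a) + - s)) + a + t"
          by (simp only: add.assoc)
        then show ?thesis by simp
      qed
      have "?I \<le> (\<integral>\<^sup>+t. ?g (- a + - s + a + t) \<partial>m)"
      proof (rule nn_integral_mono)
        fix t
        have "t \<in> W1 \<Longrightarrow> - a + - s + a + t \<in> ?W" using W1(4) s by auto
        then show "ennreal (\<phi> (u + a + t)) * indicator W1 t \<le> ?g (- a + - s + a + t)"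
          unfolding eq by (auto simp: indicator_def)
      qed
      also have "\<dots> = (\<integral>\<^sup>+t. ?g t \<partial>m)" by (rule nn_integral_translate) measurable
      also have "\<dots> \<le> ennreal (2 / h a * P \<phi> (u + s))" using \<phi> by (intro spread_one_step a) auto
      finally have "ennreal (h a / 2) * ?I \<le> ennreal (h a / 2) * ennreal (2 / h a * P \<phi> (u + s))"
        by (rule mult_left_mono) simp
      also have "\<dots> = ennreal (P \<phi> (u + s))" using a by (simp add: ennreal_mult'[symmetric])
      finally show ?thesis .
    qed
    \<comment> \<open>The bound \<open>Ps\<close> does not depend on \<open>s\<close> on its left
      side; integrating it over \<open>?V\<close> gains the factor \<open>v\<close> and brings in
      the hypothesis on \<open>u\<close>, applied to \<open>P \<phi>\<close>.\<close>
    have "ennreal k = ennreal v * ennreal (h a / 2)"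
      unfolding k_def using v a by (intro ennreal_mult) auto
    then have "ennreal k * ?I \<le> ennreal (h a / 2) * ?I * emeasure m ?V"
      using mult_right_mono[OF v(2), of "ennreal (h a / 2) * ?I"] by (simp add: mult_ac)
    also have "\<dots> = (\<integral>\<^sup>+s. ennreal (h a / 2) * ?I * indicator ?V s \<partial>m)"
      using V W1 by (intro nn_integral_cmult_indicator[symmetric]) (auto simp: sets_m)
    also have "\<dots> \<le> (\<integral>\<^sup>+s. ennreal (P \<phi> (u + s)) * indicator V s \<partial>m)"
      using Ps by (intro nn_integral_mono) (auto simp: indicator_def)
    also have "\<dots> \<le> ennreal (C * Pn j (P \<phi>) 0)"
      using \<phi> Pn_nonneg[of \<phi> "Suc 0"] by (intro spr nice_P) auto
    finally have "ennreal (1 / k) * (ennreal k * ?I) \<le> ennreal (1 / k) * ennreal (C * Pn j (P \<phi>) 0)"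
      by (rule mult_left_mono) simp
    moreover have "ennreal (1 / k) * (ennreal k * ?I) = ?I"
      using k by (simp add: mult.assoc[symmetric] ennreal_mult'[symmetric])
    moreover have "ennreal (1 / k) * ennreal (C * Pn j (P \<phi>) 0) = ennreal (C / k * Pn (Suc j) \<phi> 0)"
      using k by (simp add: ennreal_mult'[symmetric] funpow_Suc_right del: funpow.simps)
    ultimately show ?thesis by simp
  qed
  then show ?thesis
    unfolding spread_def using W1 C k
    by (intro exI[of _ "C / k"] exI[of _ "Suc j"] exI[of _ W1] conjI) auto
qed

text \<open>The open set where \<open>h\<close> is positive has mass \<open>1\<close>, and so has
  its inverse by symmetry. Hence they meet, which supplies the pair \<open>y\<close>,
  \<open>- y\<close> needed to reach the whole connected group.\<close>

lemma spread_all: "spread u"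
proof -
  let ?H = "{x. 0 < h x}"
  have H_open: "open ?H" by (intro open_Collect_less continuous_intros h_cont)
  then have H: "?H \<in> sets \<mu>" by (simp add: sets_mu)
  have "emeasure \<mu> ?H = (\<integral>\<^sup>+s. ennreal (h s) * indicator ?H s \<partial>m)"
    using H by (subst mu_density, subst emeasure_density) (auto simp: sets_mu sets_m)
  also have "\<dots> = (\<integral>\<^sup>+s. ennreal (h s) * indicator UNIV s \<partial>m)"
    using h_nonneg by (intro nn_integral_cong) (auto simp: indicator_def not_less dest: antisym)
  also have "\<dots> = emeasure \<mu> UNIV"
    by (subst mu_density, subst emeasure_density) (auto simp: sets_m)
  also have "\<dots> = 1" using emeasure_space_1 by simp
  finally have 1: "emeasure \<mu> ?H = 1" .
  moreover have 2: "emeasure \<mu> (uminus ` ?H) = emeasure \<mu> ?H"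
    using court H by (auto simp: courteous_def sets_mu)
  have "?H \<inter> uminus ` ?H \<noteq> {}"
  proof
    assume "?H \<inter> uminus ` ?H = {}"
    moreover have "uminus ` ?H = uminus -` ?H" by force
    moreover have "open (uminus -` ?H)" by (intro open_vimage H_open continuous_intros)
    ultimately have "emeasure \<mu> (?H \<union> uminus ` ?H) = 1 + 1"
      using 1 2 H by (subst plus_emeasure[symmetric]) (auto simp: sets_mu)
    then show False using emeasure_space_le_1
      by (metis emeasure_space one_add_one order.trans one_less_numeral_iff not_le semiring_norm(76))
  qed
  then obtain y where "y \<in> ?H" "- y \<in> ?H" by force
  then have "{u. spread u} = UNIV"
    using spread_base spread_step
    by (intro open_semigroup_UNIV[OF connected_group H_open]) auto
  then show ?thesis by auto
qed

end

subsection \<open>Decay of derivatives along the walk\<close>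

text \<open>A shift by \<open>j\<close> splits into \<open>j\<close> unit shifts; each telescopes to
  a difference of two values of \<open>F\<close>, at most \<open>F (2 * n + j)\<close>.\<close>

lemma sum_shift_diff_le:
  fixes F :: "nat \<Rightarrow> real"
  assumes "mono F" "\<And>i. 0 \<le> F i"
  shows "(\<Sum>i<n. F (n + i + j) - F (n + i)) \<le> real j * F (2 * n + j)"
proof (induction j)
  case (Suc j)
  have "(\<Sum>i<n. F (n + i + Suc j) - F (n + i)) =
      (\<Sum>i<n. F (n + i + j) - F (n + i)) + (\<Sum>i<n. F (n + Suc i + j) - F (n + i + j))"
    by (simp add: sum.distrib[symmetric])
  also have "(\<Sum>i<n. F (n + Suc i + j) - F (n + i + j)) = F (n + n + j) - F (n + 0 + j)"
    by (rule sum_lessThan_telescope)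
  also have "\<dots> \<le> F (2 * n + Suc j)"
    using monoD[OF assms(1), of "n + n + j" "2 * n + Suc j"] assms(2)[of "n + 0 + j"] by simp
  also have "(\<Sum>i<n. F (n + i + j) - F (n + i)) \<le> real j * F (2 * n + Suc j)"
    using Suc monoD[OF assms(1), of "2 * n + j" "2 * n + Suc j"]
    by (smt (verit) mult_left_mono of_nat_0_le_iff le_add1 add_Suc_right le_Suc_eq order.refl)
  finally show ?case by (simp add: algebra_simps)
qed simp

context courteous_walk
begin

text \<open>By \<open>comm\<close>, the point \<open>u + x + s\<close> can be reached from
  \<open>u + x\<close> by the increment \<open>s\<close> and, as far as \<open>f\<close> sees, from
  \<open>x\<close> by the increment \<open>u + s\<close>. Averaging over small \<open>s\<close>,
  spreading at \<open>0\<close> and at \<open>u\<close> bounds both squared differences by variances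
  of the walk.\<close>

lemma left_diff_square_le:
  assumes f: "nice f" "P f = f" and comm: "\<And>x y. f (u + x + y) = f (x + u + y)"
  shows "\<exists>C\<ge>0. \<exists>j. \<forall>x. (f (u + x) - f x)\<^sup>2 \<le>
    C * ((Pn j (\<lambda>s. (f s)\<^sup>2) x - (f x)\<^sup>2) + (Pn j (\<lambda>s. (f s)\<^sup>2) (u + x) - (f (u + x))\<^sup>2))"
proof -
  let ?q = "\<lambda>s. (f s)\<^sup>2"
  obtain C1 j1 V1 where C1: "C1 \<ge> 0" and V1: "open V1" "0 \<in> V1"
    and spr1: "\<And>\<phi>. nice \<phi> \<Longrightarrow> (\<And>x. 0 \<le> \<phi> x) \<Longrightarrow>
     (\<integral>\<^sup>+s. ennreal (\<phi> (u + s)) * indicator V1 s \<partial>m) \<le> ennreal (C1 * Pn j1 \<phi> 0)"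
    using spread_all[of u] unfolding spread_def by meson
  obtain C2 j2 V2 where C2: "C2 \<ge> 0" and V2: "open V2" "0 \<in> V2"
    and spr2: "\<And>\<phi>. nice \<phi> \<Longrightarrow> (\<And>x. 0 \<le> \<phi> x) \<Longrightarrow>
     (\<integral>\<^sup>+s. ennreal (\<phi> (0 + s)) * indicator V2 s \<partial>m) \<le> ennreal (C2 * Pn j2 \<phi> 0)"
    using spread_all[of 0] unfolding spread_def by meson
  let ?V = "V1 \<inter> V2"
  have "open ?V" "?V \<noteq> {}" using V1 V2 by auto
  then obtain v where v: "v > 0" "ennreal v \<le> emeasure m ?V" using open_measure_lower by blast
  \<comment> \<open>Second moments increase with time, so the larger number of steps serves both
    starting points.\<close>
  define j where "j = max j1 j2"
  define C where "C = 2 * (C1 + C2) / v"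
  have C0: "C \<ge> 0" using C1 C2 v by (simp add: C_def)
  have "(f (u + x) - f x)\<^sup>2 \<le> C * ((Pn j ?q x - (f x)\<^sup>2) + (Pn j ?q (u + x) - (f (u + x))\<^sup>2))" for x
  proof -
    define \<phi>1 where "\<phi>1 s = (f (x + s) - f x)\<^sup>2" for s
    define \<phi>2 where "\<phi>2 s = (f (u + x + s) - f (u + x))\<^sup>2" for s
    have nice1: "nice \<phi>1" unfolding \<phi>1_def by (intro nice_intros nice_translate f)
    have nice2: "nice \<phi>2" unfolding \<phi>2_def by (intro nice_intros nice_translate f)
    have [measurable]: "(\<lambda>s. \<phi>1 (u + s)) \<in> borel_measurable borel" "\<phi>2 \<in> borel_measurable borel"
      using nice_translate[OF nice1] nice2 by (auto intro: nice_measurable)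
    have [measurable]: "V1 \<in> sets borel" "V2 \<in> sets borel" using V1 V2 by auto
    have E1: "Pn j1 \<phi>1 0 \<le> Pn j ?q x - (f x)\<^sup>2"
      unfolding \<phi>1_def Pn_variance[OF f] using Pn_square_mono[OF f, of j1 j x] by (simp add: j_def)
    have E2: "Pn j2 \<phi>2 0 \<le> Pn j ?q (u + x) - (f (u + x))\<^sup>2"
      unfolding \<phi>2_def Pn_variance[OF f] using Pn_square_mono[OF f, of j2 j "u + x"] by (simp add: j_def)
    have E10: "0 \<le> Pn j1 \<phi>1 0" "0 \<le> Pn j2 \<phi>2 0" by (auto intro!: Pn_nonneg simp: \<phi>1_def \<phi>2_def)
    let ?g = "(f (u + x) - f x)\<^sup>2"
    have "ennreal ?g * ennreal v \<le> ennreal ?g * emeasure m ?V"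
      by (intro mult_left_mono v) simp
    also have "\<dots> = (\<integral>\<^sup>+s. ennreal ?g * indicator ?V s \<partial>m)"
      by (intro nn_integral_cmult_indicator[symmetric]) (auto simp: sets_m)
    also have "\<dots> \<le> (\<integral>\<^sup>+s. 2 * (ennreal (\<phi>1 (u + s)) * indicator V1 s)
        + 2 * (ennreal (\<phi>2 s) * indicator V2 s) \<partial>m)"
    proof (rule nn_integral_mono)
      fix s
      \<comment> \<open>This is \<open>(a + b)\<^sup>2 \<le> 2 a\<^sup>2 + 2 b\<^sup>2\<close> with
        intermediate value \<open>f (u + x + s)\<close>, identified with
        \<open>f (x + u + s)\<close> by \<open>comm\<close>.\<close>
      have "?g \<le> 2 * \<phi>1 (u + s) + 2 * \<phi>2 s"
        using comm[of x s] sum_squares_bound[of "f (u + x) - f (u + x + s)" "f (u + x + s) - f x"]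
        by (simp add: \<phi>1_def \<phi>2_def add.assoc power2_eq_square algebra_simps)
      then have "ennreal ?g \<le> ennreal (2 * \<phi>1 (u + s) + 2 * \<phi>2 s)" by (rule ennreal_leI)
      also have "\<dots> = 2 * ennreal (\<phi>1 (u + s)) + 2 * ennreal (\<phi>2 s)"
        by (simp add: \<phi>1_def \<phi>2_def ennreal_mult)
      finally show "ennreal ?g * indicator ?V s \<le> 2 * (ennreal (\<phi>1 (u + s)) * indicator V1 s)
        + 2 * (ennreal (\<phi>2 s) * indicator V2 s)"
        by (auto simp: indicator_def)
    qed
    also have "\<dots> = 2 * (\<integral>\<^sup>+s. ennreal (\<phi>1 (u + s)) * indicator V1 s \<partial>m)
        + 2 * (\<integral>\<^sup>+s. ennreal (\<phi>2 s) * indicator V2 s \<partial>m)"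
      by (subst nn_integral_add, measurable, subst nn_integral_cmult, measurable,
          subst nn_integral_cmult, measurable)
    also have "\<dots> \<le> 2 * ennreal (C1 * Pn j1 \<phi>1 0) + 2 * ennreal (C2 * Pn j2 \<phi>2 0)"
      using spr1[OF nice1] spr2[OF nice2] by (intro add_mono mult_left_mono) (auto simp: \<phi>1_def \<phi>2_def)
    also have "\<dots> = ennreal (2 * (C1 * Pn j1 \<phi>1 0) + 2 * (C2 * Pn j2 \<phi>2 0))"
      using C1 C2 E10 by (simp add: ennreal_mult)
    finally have "?g * v \<le> 2 * (C1 * Pn j1 \<phi>1 0) + 2 * (C2 * Pn j2 \<phi>2 0)"
      using v C1 C2 E10 by (simp add: ennreal_mult'[symmetric] ennreal_le_iff del: ennreal_plus)
    also have "\<dots> \<le> 2 * ((C1 + C2) * Pn j1 \<phi>1 0) + 2 * ((C1 + C2) * Pn j2 \<phi>2 0)"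
      using C1 C2 E10 by (intro add_mono mult_left_mono mult_right_mono) auto
    also have "\<dots> = 2 * (C1 + C2) * (Pn j1 \<phi>1 0 + Pn j2 \<phi>2 0)" by (simp add: algebra_simps)
    also have "\<dots> \<le> 2 * (C1 + C2) * ((Pn j ?q x - (f x)\<^sup>2) + (Pn j ?q (u + x) - (f (u + x))\<^sup>2))"
      using E1 E2 C1 C2 by (intro mult_left_mono add_mono) auto
    finally show ?thesis using v by (simp add: C_def field_simps)
  qed
  then show ?thesis using C0 by blast
qed

text \<open>The mean square of the derivative increases in time, so \<open>n\<close> times its value
  at time \<open>n\<close> is at most its sum over times \<open>n\<close> to \<open>2 n - 1\<close>.
  Each summand is bounded by an increase of the second moment of \<open>f\<close> over
  \<open>j\<close> steps, and these increases telescope.\<close>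

lemma left_diff_decay:
  assumes f: "nice f" "P f = f" and comm: "\<And>x y. f (u + x + y) = f (x + u + y)"
  shows "\<exists>C\<ge>0. \<exists>j. \<forall>n x. real n * Pn n (\<lambda>s. (f (u + s) - f s)\<^sup>2) x \<le>
    C * (Pn (2 * n + j) (\<lambda>s. (f s)\<^sup>2) x + Pn (2 * n + j) (\<lambda>s. (f s)\<^sup>2) (u + x))"
proof -
  let ?q = "\<lambda>s. (f s)\<^sup>2"
  define g where "g s = f (u + s) - f s" for s
  obtain C j where C: "C \<ge> 0" and le: "\<And>x. (g x)\<^sup>2 \<le>
    C * ((Pn j ?q x - (f x)\<^sup>2) + (Pn j ?q (u + x) - (f (u + x))\<^sup>2))"
    using left_diff_square_le[OF f comm] unfolding g_def by blast
  have nq: "nice ?q" by (intro nice_intros f)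
  have nf: "nice (\<lambda>s. f (u + s))" by (intro nice_translate f)
  have ng: "nice g" unfolding g_def by (intro nice_intros nf f)
  have Pf: "P (\<lambda>s. f (u + s)) = (\<lambda>s. f (u + s))"
    using Pn_translate[of 1 f u] f(2) by simp
  have Pg: "P g = g"
    using Pn_diff[OF nf f(1), of 1] Pf f(2) by (simp add: g_def[abs_def])
  have "real n * Pn n (\<lambda>s. (g s)\<^sup>2) x \<le> (C * real j) * (Pn (2 * n + j) ?q x + Pn (2 * n + j) ?q (u + x))"
    for n x
  proof -
    define F where "F i = Pn i ?q x + Pn i ?q (u + x)" for i
    have F: "mono F" "\<And>i. 0 \<le> F i"
      unfolding F_def using Pn_square_mono[OF f] Pn_nonneg[of ?q] by (auto intro!: monoI add_mono)
    have step: "Pn i (\<lambda>s. (g s)\<^sup>2) x \<le> C * (F (i + j) - F i)" for i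
    proof -
      let ?D = "\<lambda>x. Pn j ?q x - ?q x"
      have nD: "nice ?D" by (intro nice_intros nice_Pn f)
      have D: "Pn i ?D y = Pn (i + j) ?q y - Pn i ?q y" for y
        using Pn_diff[OF nice_Pn[OF nq, of j] nq, of i] by (simp add: Pn_Pn)
      have "Pn i (\<lambda>s. (g s)\<^sup>2) x \<le> Pn i (\<lambda>x. C * (?D x + ?D (u + x))) x"
        by (rule Pn_mono[OF _ _ le]) (intro nice_intros ng nice_Pn nice_translate f)+
      also have "\<dots> = C * (Pn i ?D x + Pn i (\<lambda>x. ?D (u + x)) x)"
        unfolding Pn_cmult using Pn_add[OF nD nice_translate[OF nD]] by simp
      also have "Pn i (\<lambda>x. ?D (u + x)) x = Pn i ?D (u + x)"
        using Pn_translate[of i ?D u] by simp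
      finally show ?thesis by (simp add: D F_def algebra_simps)
    qed
    have "real n * Pn n (\<lambda>s. (g s)\<^sup>2) x = (\<Sum>i<n. Pn n (\<lambda>s. (g s)\<^sup>2) x)" by simp
    also have "\<dots> \<le> (\<Sum>i<n. Pn (n + i) (\<lambda>s. (g s)\<^sup>2) x)"
      by (intro sum_mono Pn_square_mono ng Pg) simp
    also have "\<dots> \<le> (\<Sum>i<n. C * (F (n + i + j) - F (n + i)))"
      by (intro sum_mono step)
    also have "\<dots> \<le> C * (real j * F (2 * n + j))"
      unfolding sum_distrib_left[symmetric] by (intro mult_left_mono sum_shift_diff_le F C)
    finally show ?thesis by (simp add: F_def mult_ac)
  qed
  then show ?thesis unfolding g_def using C by (intro exI[of _ "C * real j"] conjI exI[of _ j]) auto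
qed

text \<open>The constant may depend on the starting point, since only decay along the walk from a
  fixed point is needed. Time \<open>0\<close> is left out, because \<open>0 ^ \<alpha>\<close>
  vanishes for positive \<open>\<alpha>\<close>.\<close>

definition rate :: "nat \<Rightarrow> ('a \<Rightarrow> real) \<Rightarrow> bool" where
  "rate \<alpha> f \<longleftrightarrow> (\<forall>x. \<exists>C. \<forall>n\<ge>1. Pn n (\<lambda>s. (f s)\<^sup>2) x \<le> C * real n ^ \<alpha>)"

lemma rate_growth:
  assumes "f \<in> borel_measurable borel" "\<And>x. \<bar>f x\<bar> \<le> A * wt x ^ p"
  shows "rate (2 * p) f"
  unfolding rate_def
proof
  fix x
  have n: "nice f" by (rule niceI[OF assms])
  have q: "\<bar>(f x)\<^sup>2\<bar> \<le> A\<^sup>2 * wt x ^ (2 * p)" for x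
  proof -
    have "\<bar>f x\<bar>\<^sup>2 \<le> (A * wt x ^ p)\<^sup>2" by (intro power_mono assms) simp
    then show ?thesis by (simp add: power_mult_distrib power_mult[symmetric] mult.commute)
  qed
  from Pn_growth[OF nice_power2[OF n] this] obtain K where K: "K \<ge> 1"
    "\<And>n x. \<bar>Pn n (\<lambda>x. (f x)\<^sup>2) x\<bar> \<le> A\<^sup>2 * (wt x + real n * K) ^ (2 * p)" by blast
  have "Pn n (\<lambda>s. (f s)\<^sup>2) x \<le> (A\<^sup>2 * (wt x + K) ^ (2 * p)) * real n ^ (2 * p)" if "n \<ge> 1" for n
  proof -
    have "wt x * 1 \<le> wt x * real n" using that wt_ge1[of x] by (intro mult_left_mono) auto
    then have "wt x + real n * K \<le> (wt x + K) * real n" by (simp add: algebra_simps)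
    then have "A\<^sup>2 * (wt x + real n * K) ^ (2 * p) \<le> A\<^sup>2 * ((wt x + K) * real n) ^ (2 * p)"
      using wt_ge1[of x] K by (intro mult_left_mono power_mono) auto
    then show ?thesis using K(2)[of n x] by (simp add: power_mult_distrib mult_ac)
  qed
  then show "\<exists>C. \<forall>n\<ge>1. Pn n (\<lambda>s. (f s)\<^sup>2) x \<le> C * real n ^ (2 * p)" by blast
qed

lemma rate_bound2:
  assumes "rate \<alpha> f"
  shows "\<exists>B\<ge>0. \<forall>n\<ge>1. Pn (2 * n + j) (\<lambda>s. (f s)\<^sup>2) x + Pn (2 * n + j) (\<lambda>s. (f s)\<^sup>2) y \<le> B * real n ^ \<alpha>"
proof -
  let ?q = "\<lambda>s. (f s)\<^sup>2"
  obtain C1 where C1: "\<And>n. n \<ge> 1 \<Longrightarrow> Pn n ?q x \<le> C1 * real n ^ \<alpha>"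
    using assms unfolding rate_def by meson
  obtain C2 where C2: "\<And>n. n \<ge> 1 \<Longrightarrow> Pn n ?q y \<le> C2 * real n ^ \<alpha>"
    using assms unfolding rate_def by meson
  have C12: "C1 + C2 \<ge> 0"
    using C1[of 1] C2[of 1] Pn_nonneg[of ?q 1 x] Pn_nonneg[of ?q 1 y] by (simp del: One_nat_def)
  have "Pn (2 * n + j) ?q x + Pn (2 * n + j) ?q y \<le> ((C1 + C2) * real (2 + j) ^ \<alpha>) * real n ^ \<alpha>"
    if n: "n \<ge> 1" for n
  proof -
    have "2 * n + j \<le> (2 + j) * n" using n by (simp add: algebra_simps)
    then have "real (2 * n + j) \<le> real (2 + j) * real n" by (metis of_nat_le_iff of_nat_mult)
    then have "real (2 * n + j) ^ \<alpha> \<le> (real (2 + j) * real n) ^ \<alpha>" by (intro power_mono) auto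
    then have "(C1 + C2) * real (2 * n + j) ^ \<alpha> \<le> (C1 + C2) * (real (2 + j) * real n) ^ \<alpha>"
      using C12 by (rule mult_left_mono)
    moreover have "Pn (2 * n + j) ?q x + Pn (2 * n + j) ?q y \<le> (C1 + C2) * real (2 * n + j) ^ \<alpha>"
      using C1[of "2 * n + j"] C2[of "2 * n + j"] n by (simp add: algebra_simps)
    ultimately show ?thesis by (simp only: power_mult_distrib mult.assoc)
  qed
  moreover have "(C1 + C2) * real (2 + j) ^ \<alpha> \<ge> 0" using C12 by simp
  ultimately show ?thesis by blast
qed

text \<open>The factor \<open>n\<close> gained in \<open>left_diff_decay\<close> lowers the exponent
  by one.\<close>

lemma rate_left_diff:
  assumes f: "nice f" "P f = f" and comm: "\<And>x y. f (u + x + y) = f (x + u + y)"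
    and "rate (Suc \<alpha>) f"
  shows "rate \<alpha> (\<lambda>s. f (u + s) - f s)"
  unfolding rate_def
proof
  fix x
  obtain C j where C: "C \<ge> 0" and le: "\<And>n x. real n * Pn n (\<lambda>s. (f (u + s) - f s)\<^sup>2) x \<le>
    C * (Pn (2 * n + j) (\<lambda>s. (f s)\<^sup>2) x + Pn (2 * n + j) (\<lambda>s. (f s)\<^sup>2) (u + x))"
    using left_diff_decay[OF f comm] by blast
  obtain B where B: "\<And>n. n \<ge> 1 \<Longrightarrow>
     Pn (2 * n + j) (\<lambda>s. (f s)\<^sup>2) x + Pn (2 * n + j) (\<lambda>s. (f s)\<^sup>2) (u + x) \<le> B * real n ^ Suc \<alpha>"
    using rate_bound2[OF assms(4)] by meson
  have "Pn n (\<lambda>s. (f (u + s) - f s)\<^sup>2) x \<le> (C * B) * real n ^ \<alpha>" if n: "n \<ge> 1" for n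
  proof -
    have "real n * Pn n (\<lambda>s. (f (u + s) - f s)\<^sup>2) x \<le> C * (B * real n ^ Suc \<alpha>)"
      using le[of n x] mult_left_mono[OF B[OF n] C] by linarith
    also have "\<dots> = real n * (C * B * real n ^ \<alpha>)" by simp
    finally show ?thesis using n by (subst (asm) mult_le_cancel_left_pos) auto
  qed
  then show "\<exists>C. \<forall>n\<ge>1. Pn n (\<lambda>s. (f (u + s) - f s)\<^sup>2) x \<le> C * real n ^ \<alpha>" by blast
qed

text \<open>With bounded second moments the gain of \<open>n\<close> has nothing left to cancel:
  \<open>n * (g x)\<^sup>2\<close> stays bounded by subharmonicity, which forces
  \<open>g x = 0\<close>.\<close>

lemma rate0_left_diff:
  assumes f: "nice f" "P f = f" and comm: "\<And>x y. f (u + x + y) = f (x + u + y)"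
    and "rate 0 f"
  shows "f (u + x) - f x = 0"
proof -
  define g where "g s = f (u + s) - f s" for s
  obtain C j where C: "C \<ge> 0" and le: "\<And>n x. real n * Pn n (\<lambda>s. (g s)\<^sup>2) x \<le>
    C * (Pn (2 * n + j) (\<lambda>s. (f s)\<^sup>2) x + Pn (2 * n + j) (\<lambda>s. (f s)\<^sup>2) (u + x))"
    using left_diff_decay[OF f comm] unfolding g_def by blast
  obtain B where B: "\<And>n. n \<ge> 1 \<Longrightarrow>
     Pn (2 * n + j) (\<lambda>s. (f s)\<^sup>2) x + Pn (2 * n + j) (\<lambda>s. (f s)\<^sup>2) (u + x) \<le> B * real n ^ 0"
    using rate_bound2[OF assms(4)] by meson
  have nf: "nice (\<lambda>s. f (u + s))" by (intro nice_translate f)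
  have ng: "nice g" unfolding g_def by (intro nice_intros nf f)
  have Pf: "P (\<lambda>s. f (u + s)) = (\<lambda>s. f (u + s))"
    using Pn_translate[of 1 f u] f(2) by simp
  have Pg: "P g = g"
    using Pn_diff[OF nf f(1), of 1] Pf f(2) by (simp add: g_def[abs_def])
  have key: "real n * (g x)\<^sup>2 \<le> C * B" if n: "n \<ge> 1" for n
  proof -
    have "real n * (g x)\<^sup>2 \<le> real n * Pn n (\<lambda>s. (g s)\<^sup>2) x"
      using Pn_square_mono[OF ng Pg, of 0 n x] by (intro mult_left_mono) auto
    also have "\<dots> \<le> C * B" using le[of n x] mult_left_mono[OF B[OF n] C] by simp
    finally show ?thesis .
  qed
  have "(g x)\<^sup>2 = 0"
  proof (rule ccontr)
    assume "(g x)\<^sup>2 \<noteq> 0"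
    then have c: "(g x)\<^sup>2 > 0" by simp
    obtain n where n: "C * B < real n * (g x)\<^sup>2" using reals_Archimedean3[OF c] by blast
    have "real n * (g x)\<^sup>2 \<le> real (Suc n) * (g x)\<^sup>2" by (intro mult_right_mono) auto
    then show False using key[of "Suc n"] n by simp
  qed
  then show ?thesis by (simp add: g_def)
qed

end

subsection \<open>Descent along the lower central series\<close>

lemma generated_subgroup_mono: "A \<subseteq> B \<Longrightarrow> generated_subgroup A \<subseteq> generated_subgroup B"
proof
  fix x assume "A \<subseteq> B" "x \<in> generated_subgroup A"
  from this(2) show "x \<in> generated_subgroup B"
    by induction (use \<open>A \<subseteq> B\<close> in \<open>auto intro: generated_subgroup.intros\<close>)
qed

lemma lower_central_series_Suc_subset:
  "lower_central_series (Suc i) \<subseteq> (lower_central_series i :: 'a::group_add set)"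
proof (induction i)
  case (Suc i)
  have "{- x + - y + x + y |x y. x \<in> lower_central_series (Suc i)} \<subseteq>
      {- x + - y + x + y |x y :: 'a. x \<in> lower_central_series i}"
    using Suc by blast
  from generated_subgroup_mono[OF this] show ?case by (simp only: lower_central_series.simps)
qed simp

lemma commutator_mem_lower_central_series:
  "x \<in> lower_central_series i \<Longrightarrow> - x + - y + x + y \<in> lower_central_series (Suc i)"
  unfolding lower_central_series.simps(2) by (rule generated_subgroup.incl) blast

lemma commutator_swap: "x + y = y + x + (- x + - y + x + (y :: 'a::group_add))"
proof -
  have "y + x + (- x + - y + x + y) = y + ((x + - x) + - y) + x + y" by (simp only: add.assoc)
  then show ?thesis by simp
qed

context courteous_walk
begin

text \<open>Invariance under right multiplication is the induction parameter: for
  \<open>i = 0\<close> it leaves only constants, and once the series is trivial it is no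
  restriction.\<close>

definition harm :: "nat \<Rightarrow> nat \<Rightarrow> ('a \<Rightarrow> real) \<Rightarrow> bool" where
  "harm p i f \<longleftrightarrow> f \<in> borel_measurable borel \<and> (\<exists>A. \<forall>x. \<bar>f x\<bar> \<le> A * wt x ^ p) \<and> P f = f \<and>
     (\<forall>w\<in>lower_central_series i. \<forall>x. f (x + w) = f x)"

definition ldiff :: "'a \<Rightarrow> ('a \<Rightarrow> real) \<Rightarrow> 'a \<Rightarrow> real" where
  "ldiff u f x = f (u + x) - f x"

lemma harm_nice: "harm p i f \<Longrightarrow> nice f"
  unfolding harm_def nice_def by blast

text \<open>Swapping \<open>u\<close> and \<open>x\<close> produces a commutator \<open>?w\<close>
  in the next term. Moving \<open>?w\<close> to the right past \<open>y\<close> produces a further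
  commutator, still in that term, and invariance removes both; normality of the series is thus
  bypassed.\<close>

lemma harm_comm:
  assumes "harm p (Suc i) f" "u \<in> lower_central_series i"
  shows "f (u + x + y) = f (x + u + y)"
proof -
  have inv: "f (x + w) = f x" if "w \<in> lower_central_series (Suc i)" for x w
    using assms(1) that by (auto simp: harm_def)
  let ?w = "- u + - x + u + x"
  have w: "?w \<in> lower_central_series (Suc i)" by (rule commutator_mem_lower_central_series[OF assms(2)])
  then have "- ?w + - y + ?w + y \<in> lower_central_series (Suc i)"
    using commutator_mem_lower_central_series lower_central_series_Suc_subset by blast
  note wy = this
  have "f (u + x + y) = f (x + u + ?w + y)" by (subst commutator_swap[of u x]) simp
  also have "\<dots> = f (x + u + (?w + y))" by (simp only: add.assoc)
  also have "\<dots> = f (x + u + (y + ?w + (- ?w + - y + ?w + y)))"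
    by (subst commutator_swap[of ?w y]) (rule refl)
  also have "\<dots> = f (x + u + y + ?w + (- ?w + - y + ?w + y))" by (simp only: add.assoc)
  also have "\<dots> = f (x + u + y)" by (simp only: inv[OF wy] inv[OF w])
  finally show ?thesis .
qed

lemma harm_ldiff:
  assumes "harm p i f"
  shows "harm p i (ldiff u f)"
proof -
  obtain A where A: "\<And>x. \<bar>f x\<bar> \<le> A * wt x ^ p" using assms by (auto simp: harm_def)
  note nf = harm_nice[OF assms]
  have nu: "nice (\<lambda>x. f (u + x))" by (rule nice_translate[OF nf])
  have eq: "ldiff u f = (\<lambda>x. f (u + x) - f x)" by (auto simp: ldiff_def)
  have "\<bar>ldiff u f x\<bar> \<le> (A * wt u ^ p + A) * wt x ^ p" for x
    using growth_translate[OF A, of u x] A[of x] by (simp add: ldiff_def algebra_simps)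
  moreover have "P (ldiff u f) = ldiff u f"
    using Pn_diff[OF nu nf, of 1] Pn_translate[of 1 f u] assms by (simp add: eq harm_def)
  moreover have "ldiff u f \<in> borel_measurable borel"
    unfolding eq by (intro nice_measurable nice_intros nf nu)
  moreover have "\<forall>w\<in>lower_central_series i. \<forall>x. ldiff u f (x + w) = ldiff u f x"
    using assms by (auto simp: harm_def ldiff_def add.assoc[symmetric])
  ultimately show ?thesis unfolding harm_def by blast
qed

lemma harm_foldr_ldiff: "harm p i f \<Longrightarrow> harm p i (foldr ldiff us f)"
  by (induction us) (auto intro: harm_ldiff)

lemma foldr_left_deriv_of_real:
  "foldr left_deriv us (\<lambda>x. complex_of_real (f x)) = (\<lambda>x. complex_of_real (foldr ldiff us f x))"
  by (induction us) (auto simp: left_deriv_def ldiff_def)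

lemma rate_foldr_ldiff:
  assumes "harm p (Suc i) f" "set us \<subseteq> lower_central_series i" "rate (length us + \<alpha>) f"
  shows "rate \<alpha> (foldr ldiff us f)"
  using assms(2,3)
proof (induction us arbitrary: \<alpha>)
  case (Cons u us)
  let ?g = "foldr ldiff us f"
  have g: "harm p (Suc i) ?g" by (rule harm_foldr_ldiff[OF assms(1)])
  have "rate (Suc \<alpha>) ?g" using Cons by (intro Cons.IH) auto
  then have "rate \<alpha> (\<lambda>s. ?g (u + s) - ?g s)"
    using g Cons.prems(1) harm_nice[OF g] harm_comm[OF g, of u]
    by (intro rate_left_diff) (auto simp: harm_def)
  moreover have "foldr ldiff (u # us) f = (\<lambda>s. ?g (u + s) - ?g s)" by (auto simp: ldiff_def)
  ultimately show ?case by simp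
qed simp

text \<open>Growth of degree \<open>p\<close> gives exponent \<open>2 * p\<close> for the mean
  square. The first \<open>2 * p\<close> derivatives bring it down to \<open>0\<close>, and the last
  one annihilates.\<close>

lemma central_ldiffs_vanish:
  assumes "harm p (Suc i) f" "set us \<subseteq> lower_central_series i" "length us = 2 * p + 1"
  shows "foldr ldiff us f = (\<lambda>x. 0)"
proof -
  obtain u vs where us: "us = u # vs" using assms(3) by (cases us) auto
  let ?g = "foldr ldiff vs f"
  have g: "harm p (Suc i) ?g" by (rule harm_foldr_ldiff[OF assms(1)])
  have "rate (2 * p) f" using assms(1) rate_growth unfolding harm_def by blast
  then have "rate 0 ?g" using assms us by (intro rate_foldr_ldiff[OF assms(1)]) auto
  then have "?g (u + x) - ?g x = 0" for x
    using g assms(2) us harm_nice[OF g] harm_comm[OF g, of u]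
    by (intro rate0_left_diff) (auto simp: harm_def)
  then show ?thesis by (auto simp: us ldiff_def)
qed

lemma foldr_ldiff_right_translate:
  "foldr ldiff us (\<lambda>x. f (x + v) - f x) = (\<lambda>x. foldr ldiff us f (x + v) - foldr ldiff us f x)"
  by (induction us) (auto simp: ldiff_def add.assoc)

lemma foldr_ldiff_zero: "foldr ldiff us (\<lambda>x. 0) = (\<lambda>x. 0)"
  by (induction us) (auto simp: ldiff_def)

text \<open>Induction on the number \<open>l\<close> of derivatives along the \<open>i\<close>-th
  term that kill \<open>f\<close>. For \<open>v\<close> in that term, \<open>ldiff v f\<close> needs
  only \<open>l - 1\<close> of them, so the inner block of directions kills it; hence that block
  turns \<open>f\<close> into a function invariant under the \<open>i\<close>-th term, which the
  remaining \<open>N\<close> directions kill.\<close>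

lemma harm_polynomial_inner:
  assumes N: "\<And>f us. harm p i f \<Longrightarrow> length us = N \<Longrightarrow> foldr ldiff us f = (\<lambda>x. 0)"
    and "harm p (Suc i) f"
    and "\<And>vs. set vs \<subseteq> lower_central_series i \<Longrightarrow> length vs = l \<Longrightarrow> foldr ldiff vs f = (\<lambda>x. 0)"
    and "length us = l * N"
  shows "foldr ldiff us f = (\<lambda>x. 0)"
  using assms(2-4)
proof (induction l arbitrary: f us)
  case 0
  then show ?case using 0(2)[of "[]"] by (simp add: foldr_ldiff_zero)
next
  case (Suc l)
  define us1 where "us1 = take N us"
  define us2 where "us2 = drop N us"
  have us: "us = us1 @ us2" "length us1 = N" "length us2 = l * N"
    using Suc.prems(3) by (auto simp: us1_def us2_def)
  let ?g = "foldr ldiff us2 f"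
  have "?g (x + v) = ?g x" if v: "v \<in> lower_central_series i" for x v
  proof -
    have "foldr ldiff us2 (ldiff v f) = (\<lambda>x. 0)"
    proof (rule Suc.IH[OF harm_ldiff[OF Suc.prems(1)] _ us(3)])
      fix vs :: "'a list" assume "set vs \<subseteq> lower_central_series i" "length vs = l"
      then show "foldr ldiff vs (ldiff v f) = (\<lambda>x. 0)"
        using Suc.prems(2)[of "vs @ [v]"] v by simp
    qed
    \<comment> \<open>For such \<open>v\<close> left and right differences of \<open>f\<close>
      agree, and right differences commute with all left derivatives.\<close>
    moreover have "ldiff v f = (\<lambda>x. f (x + v) - f x)"
      using harm_comm[OF Suc.prems(1) v, of _ 0] by (auto simp: ldiff_def)
    ultimately have "(\<lambda>x. ?g (x + v) - ?g x) = (\<lambda>x. 0)"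
      using foldr_ldiff_right_translate[of us2 f v] by simp
    then show ?thesis by (metis eq_iff_diff_eq_0)
  qed
  then have "harm p i ?g"
    using harm_foldr_ldiff[OF Suc.prems(1), of us2] by (auto simp: harm_def)
  then show ?case using N us by simp
qed

text \<open>The number \<open>N\<close> is uniform in \<open>f\<close>, as the induction applies it
  to derivatives of \<open>f\<close>. Each step of the series multiplies it by
  \<open>2 * p + 1\<close>.\<close>

lemma harm_polynomial:
  "\<exists>N. \<forall>f us. harm p i f \<longrightarrow> length us = N \<longrightarrow> foldr ldiff us f = (\<lambda>x. 0)"
proof (induction i)
  case 0
  have "foldr ldiff us f = (\<lambda>x. 0)" if "harm p 0 f" "length us = 1" for f us
  proof -
    obtain u where u: "us = [u]" using \<open>length us = 1\<close> by (cases us) auto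
    have "f (x + w) = f x" for x w using \<open>harm p 0 f\<close> by (simp add: harm_def)
    from this[of 0] have "f x = f 0" for x by simp
    from this[of "u + x" for x] this[of x for x] have "ldiff u f x = 0" for x
      by (metis ldiff_def right_minus_eq)
    then show ?thesis by (simp add: u fun_eq_iff)
  qed
  then show ?case by blast
next
  case (Suc i)
  then obtain N where "\<And>f us. harm p i f \<Longrightarrow> length us = N \<Longrightarrow> foldr ldiff us f = (\<lambda>x. 0)" by blast
  from harm_polynomial_inner[OF this] central_ldiffs_vanish
  show ?case by blast
qed

end

section \<open>From some polynomial degree to degree \<open>k\<close>\<close>

theorem theorem1p9:
  fixes S :: "'a::{topological_group_add, t2_space} set"
    and m \<mu> :: "'a measure"
    and k :: nat
  assumes "connected (UNIV :: 'a set)"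
    and "locally_compact_space (euclidean :: 'a topology)"
    and "compact_symmetric_generating S"
    and "left_haar_measure m" and "emeasure m S = 1"
    and "courteous m S \<mu>"
    and "nilpotent_group TYPE('a)"
    and "k \<ge> 1"
  shows "HF S k \<mu> \<subseteq> group_poly k"
proof
  fix f assume f: "f \<in> HF S k \<mu>"
  obtain h where h: "continuous_on UNIV h" "\<forall>x. 0 \<le> h x" "\<mu> = density m (\<lambda>x. ennreal (h x))"
    using assms(6) by (auto simp: courteous_def)
  interpret courteous_walk S m \<mu> h
    using assms h by unfold_locales auto
  have fm: "f \<in> borel_measurable borel"
    and fh: "\<And>x. integrable \<mu> (\<lambda>s. f (x + s))" "\<And>x. f x = (\<integral>s. f (x + s) \<partial>\<mu>)"
    using f unfolding HF_def harmonic_def by blast+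
  obtain A where A: "\<And>x. cmod (f x) \<le> A * (1 + real (word_length S x)) ^ k"
    using f growth_norm_bound[of S k f] by (auto simp: HF_def)
  obtain c where c: "lower_central_series c = {0::'a}"
    using assms(7) by (auto simp: nilpotent_group_def)
  \<comment> \<open>The martingale estimates are for real functions, so both parts are treated
    separately; invariance holds trivially because the \<open>c\<close>-th term is
    \<open>{0}\<close>.\<close>
  have "harm k c (\<lambda>x. Re (f x))"
    unfolding harm_def
  proof (intro conjI exI allI)
    show "(\<lambda>x. Re (f x)) \<in> borel_measurable borel" using fm by measurable
    show "\<bar>Re (f x)\<bar> \<le> A * wt x ^ k" for x
      using A[of x] abs_Re_le_cmod[of "f x"] by (simp add: wt_def)
    show "P (\<lambda>x. Re (f x)) = (\<lambda>x. Re (f x))"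
      unfolding P_def integral_Re[OF fh(1)] fh(2)[symmetric] ..
  qed (simp add: c)
  moreover have "harm k c (\<lambda>x. Im (f x))"
    unfolding harm_def
  proof (intro conjI exI allI)
    show "(\<lambda>x. Im (f x)) \<in> borel_measurable borel" using fm by measurable
    show "\<bar>Im (f x)\<bar> \<le> A * wt x ^ k" for x
      using A[of x] abs_Im_le_cmod[of "f x"] by (simp add: wt_def)
    show "P (\<lambda>x. Im (f x)) = (\<lambda>x. Im (f x))"
      unfolding P_def integral_Im[OF fh(1)] fh(2)[symmetric] ..
  qed (simp add: c)
  ultimately obtain N where N: "\<And>us. length us = N \<Longrightarrow> foldr ldiff us (\<lambda>x. Re (f x)) = (\<lambda>x. 0)"
      "\<And>us. length us = N \<Longrightarrow> foldr ldiff us (\<lambda>x. Im (f x)) = (\<lambda>x. 0)"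
    using harm_polynomial[of k c] by blast
  have f_eq: "f = (\<lambda>x. complex_of_real (Re (f x)) + \<i> * complex_of_real (Im (f x)))"
    by (auto simp: complex_eq)
  have kill_N: "foldr left_deriv us f = (\<lambda>x. 0)" if "length us = N" for us
    by (subst f_eq) (simp add: foldr_left_deriv_add foldr_left_deriv_scale foldr_left_deriv_of_real N that)
  \<comment> \<open>Downward induction on the excess \<open>n\<close> over \<open>k\<close>, from
    \<open>n = N\<close>, where \<open>kill_N\<close> suffices, to \<open>n = 0\<close>; each step
    applies the degree reduction with \<open>d = Suc (k + n)\<close>.\<close>
  have "length us = Suc (k + n) \<Longrightarrow> foldr left_deriv us f = (\<lambda>x. 0)" if "n \<le> N" for n us
    using that
  proof (induction n arbitrary: us rule: inc_induct)
    case base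
    then show ?case by (intro foldr_left_deriv_mono[OF kill_N]) auto
  next
    case (step n)
    show ?case
      by (rule group_poly_degree_reduce[OF S_facts(3,4) A, where d = "Suc (k + n)"])
        (use step in auto)
  qed
  from this[of 0] show "f \<in> group_poly k" by (simp add: group_poly_def)
qed

end
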